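(* Let $m\geqslant 2$, $k\geqslant 2$ and $n\geqslant 2m^k$. Write $\lambda=n\bmod m^k$ and $\lambda=\nu m^{k-1}+\mu$ with $0\leqslant\nu<m$ and $0\leqslant\mu<m^{k-1}$. Then the number of $\equiv_k$-equivalence classes of the set $\{(p_U,s_U)\mid U \text{ a factor of length } n \text{ of } \mathbf{t}_m\}$ equals \[(m^{k-1}-1)(m^3-m^2+m)+\begin{cases} b^{(1)}_{\mathbf{t}_m}(m+\nu), & \text{if }\mu=0;\\ m, &\text{otherwise.}\end{cases}\]
   Context: $\mathcal{A}_m=\{0,\ldots,m-1\}=\mathbb{Z}/m\mathbb{Z}$; $\sigma_m$ is the morphism $\sigma_m(i)=i\,(i+1)\cdots(i+m-1)$ (letters mod $m$), and $\mathbf{t}_m=\lim_{j\to\infty}\sigma_m^j(0)$. For $j\geqslant1$ and a factor $U$ of $\mathbf{t}_m$, a factorization $U=x\sigma_m^j(u)y$ is a $\sigma_m^j$-factorization if there is a factor $aub$ of $\mathbf{t}_m$ with $a,b\in\mathcal{A}_m\cup\{\varepsilon\}$, $x$ a proper suffix of $\sigma_m^j(a)$ and $y$ a proper prefix of $\sigma_m^j(b)$ ($\varepsilon$ counts as proper prefix/suffix of itself). Every factor $U$ of length $\geqslant 2m^k$ has a unique $\sigma_m^k$-factorization $U=p_U\sigma_m^k(u)s_U$, defining $(p_U,s_U)$. $\sim_1$ is abelian equivalence. $(p_1,s_1)\equiv_k(p_2,s_2)$ if there exist words $x,y,p,q,r,t$ with $|x|,|y|<m^{k-1}$, $(p_1,s_1)=(x\sigma_m^{k-1}(p),\sigma_m^{k-1}(q)y)$,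 $(p_2,s_2)=(x\sigma_m^{k-1}(r),\sigma_m^{k-1}(t)y)$, and one of $pq\sim_1 rt$, $pq\sim_1 rt\,\sigma_m(0)$, $pq\,\sigma_m(0)\sim_1 rt$ holds. $b^{(1)}_{\mathbf{t}_m}(n)$ is the abelian complexity: the number of $\sim_1$-classes of length-$n$ factors of $\mathbf{t}_m$. *)

theory Defs
  imports Complex_Main "HOL-Library.Multiset" "HOL-Library.Sublist"
begin

text \<open>Finite words are lists of natural numbers, infinite words are functions on the naturals.
  The letters of the alphabet of size \<open>m\<close> are the residues \<open>0, \<dots>, m - 1\<close>.\<close>

definition words :: "nat \<Rightarrow> nat list set" where
  "words m = lists {..<m}"

definition sigma_letter :: "nat \<Rightarrow> nat \<Rightarrow> nat list" where
  "sigma_letter m i = map (\<lambda>j. (i + j) mod m) [0..<m]"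

definition sigma :: "nat \<Rightarrow> nat list \<Rightarrow> nat list" where
  "sigma m w = concat (map (sigma_letter m) w)"

definition sigma_pow :: "nat \<Rightarrow> nat \<Rightarrow> nat list \<Rightarrow> nat list" where
  "sigma_pow m j = (sigma m ^^ j)"

text \<open>The word \<open>\<sigma>\<^sup>j(0)\<close> has length \<open>m ^ j\<close> and is a prefix of \<open>\<sigma>\<^sup>j\<^sup>+\<^sup>1(0)\<close>. As \<open>m ^ i > i\<close> for \<open>m \<ge> 2\<close>,
  the letter at position \<open>i\<close> of the limit can be read off \<open>\<sigma>\<^sup>i(0)\<close>;
  see \<open>tm_is_limit\<close> below.\<close>

definition tm :: "nat \<Rightarrow> nat \<Rightarrow> nat" where
  "tm m i = sigma_pow m i [0] ! i"

lemma sigma_append: "sigma m (u @ v) = sigma m u @ sigma m v"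
  by (simp add: sigma_def)

lemma length_sigma: "length (sigma m w) = m * length w"
  by (induction w) (auto simp: sigma_def sigma_letter_def)

lemma length_sigma_pow: "length (sigma_pow m j w) = m ^ j * length w"
  by (induction j) (auto simp: sigma_pow_def length_sigma)

lemma prefix_sigma: "prefix u v \<Longrightarrow> prefix (sigma m u) (sigma m v)"
  by (auto simp: prefix_def sigma_append)

lemma prefix_sigma_pow_Suc:
  assumes "m \<ge> 1"
  shows "prefix (sigma_pow m j [0]) (sigma_pow m (Suc j) [0])"
proof (induction j)
  case 0
  have "[0..<m] = 0 # [1..<m]"
    using assms by (simp add: upt_conv_Cons)
  then show ?case
    by (simp add: sigma_pow_def sigma_def sigma_letter_def)
next
  case (Suc j)
  from prefix_sigma[OF Suc, of m] show ?case
    by (simp add: sigma_pow_def)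
qed

lemma prefix_sigma_pow:
  assumes "m \<ge> 1" "i \<le> j"
  shows "prefix (sigma_pow m i [0]) (sigma_pow m j [0])"
  using assms(2)
proof (induction j rule: dec_induct)
  case base
  then show ?case by simp
next
  case (step j)
  then show ?case
    using prefix_sigma_pow_Suc[OF assms(1)] prefix_order.trans by blast
qed

lemma tm_is_limit:
  assumes "m \<ge> 2" "i < m ^ j"
  shows "tm m i = sigma_pow m j [0] ! i"
proof -
  have less: "i < m ^ i"
    using assms(1) power_gt_expt[of m i] by simp
  have pre: "sigma_pow m a [0] ! i = sigma_pow m b [0] ! i" if le: "a \<le> b" and lt: "i < m ^ a" for a b
  proof -
    obtain zs where "sigma_pow m b [0] = sigma_pow m a [0] @ zs"
      using prefix_sigma_pow[of m a b] assms(1) le by (auto elim: prefixE)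
    then show ?thesis
      using lt by (simp only: nth_append length_sigma_pow) simp
  qed
  show ?thesis
    using pre[of i j] pre[of j i] less assms(2) nat_le_linear[of i j] unfolding tm_def by metis
qed

definition is_factor :: "nat list \<Rightarrow> (nat \<Rightarrow> nat) \<Rightarrow> bool" where
  "is_factor U w \<longleftrightarrow> (\<exists>i. U = map w [i..<i + length U])"

definition factors :: "nat \<Rightarrow> nat \<Rightarrow> nat list set" where
  "factors m n = {U. is_factor U (tm m) \<and> length U = n}"

text \<open>The empty word counts as a proper prefix and a proper suffix of itself.\<close>

definition proper_prefix :: "nat list \<Rightarrow> nat list \<Rightarrow> bool" where
  "proper_prefix y w \<longleftrightarrow> strict_prefix y w \<or> (y = [] \<and> w = [])"

definition proper_suffix :: "nat list \<Rightarrow> nat list \<Rightarrow> bool" where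
  "proper_suffix x w \<longleftrightarrow> strict_suffix x w \<or> (x = [] \<and> w = [])"

text \<open>The words \<open>a\<close> and \<open>b\<close> of length at most one are a letter or the empty word.\<close>

definition sigma_factorization ::
    "nat \<Rightarrow> nat \<Rightarrow> nat list \<Rightarrow> nat list \<Rightarrow> nat list \<Rightarrow> nat list \<Rightarrow> bool" where
  "sigma_factorization m j U x u y \<longleftrightarrow>
     U = x @ sigma_pow m j u @ y \<and>
     (\<exists>a b. length a \<le> 1 \<and> length b \<le> 1 \<and> is_factor (a @ u @ b) (tm m) \<and>
        proper_suffix x (sigma_pow m j a) \<and> proper_prefix y (sigma_pow m j b))"

text \<open>The pair \<open>(p\<^sub>U, s\<^sub>U)\<close>; meaningful when the factorization is unique, in particular for all
  factors of length at least \<open>2 * m ^ k\<close>.\<close>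

definition border :: "nat \<Rightarrow> nat \<Rightarrow> nat list \<Rightarrow> nat list \<times> nat list" where
  "border m k U =
     (case (THE (p, u, s). sigma_factorization m k U p u s) of (p, u, s) \<Rightarrow> (p, s))"

definition abelian_equiv :: "nat list \<Rightarrow> nat list \<Rightarrow> bool" where
  "abelian_equiv u v \<longleftrightarrow> mset u = mset v"

definition abelian_complexity :: "nat \<Rightarrow> nat \<Rightarrow> nat" where
  "abelian_complexity m n =
     card (factors m n // {(u, v). u \<in> factors m n \<and> v \<in> factors m n \<and> abelian_equiv u v})"

text \<open>The words have to be over the alphabet: \<open>sigma\<close> does not distinguish the numbers \<open>i\<close> and
  \<open>i + m\<close>, while abelian equivalence does.\<close>

definition border_equiv ::
    "nat \<Rightarrow> nat \<Rightarrow> nat list \<times> nat list \<Rightarrow> nat list \<times> nat list \<Rightarrow> bool" where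
  "border_equiv m k P1 P2 \<longleftrightarrow>
     (\<exists>x \<in> words m. \<exists>y \<in> words m. \<exists>p \<in> words m. \<exists>q \<in> words m. \<exists>r \<in> words m. \<exists>t \<in> words m.
        length x < m ^ (k - 1) \<and> length y < m ^ (k - 1) \<and>
        P1 = (x @ sigma_pow m (k - 1) p, sigma_pow m (k - 1) q @ y) \<and>
        P2 = (x @ sigma_pow m (k - 1) r, sigma_pow m (k - 1) t @ y) \<and>
        (abelian_equiv (p @ q) (r @ t) \<or>
         abelian_equiv (p @ q) (r @ t @ sigma m [0]) \<or>
         abelian_equiv (p @ q @ sigma m [0]) (r @ t)))"

definition border_classes :: "nat \<Rightarrow> nat \<Rightarrow> nat \<Rightarrow> (nat list \<times> nat list) set set" where
  "border_classes m k n =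
     (let S = border m k ` factors m n
      in S // {(P1, P2). P1 \<in> S \<and> P2 \<in> S \<and> border_equiv m k P1 P2})"

end

theory Submission
  imports Defs "HOL-Number_Theory.Cong" "HOL-Library.Function_Algebras"
begin

text \<open>
  The letter of \<open>t\<^sub>m\<close> at position \<open>i\<close> is the digit sum of \<open>i\<close> in base \<open>m\<close>, modulo \<open>m\<close>. Two
  occurrences of a factor of length \<open>2 m\<^sup>k\<close> are congruent modulo \<open>m\<^sup>k\<close>, so the borders of a long
  factor can be read off from any occurrence.

  Put \<open>K = m\<^sup>k\<^sup>-\<^sup>1\<close>, let a factor of length \<open>n\<close> occupy the positions strictly between \<open>p\<close> and \<open>E\<close>, and
  let \<open>u = p div K\<close> and \<open>v = E div K\<close>. The borders are \<open>x \<sigma>\<^sup>k\<^sup>-\<^sup>1(p\<^sub>1)\<close> and \<open>\<sigma>\<^sup>k\<^sup>-\<^sup>1(q\<^sub>1) y\<close>, where \<open>x\<close>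
  ends the image of the \<open>u\<close>-th letter and \<open>y\<close> begins the image of the \<open>v\<close>-th letter. Their class is given by
  \<open>x\<close>, \<open>y\<close> and the Parikh vector of \<open>p\<^sub>1 q\<^sub>1\<close> modulo constant vectors, that is, its cyclic difference.
  As every \<open>\<sigma>(a)\<close> has a constant Parikh vector, \<open>p\<^sub>1 q\<^sub>1\<close> may be replaced by the word of all letters
  strictly between the positions \<open>u\<close> and \<open>v\<close>. If \<open>c\<close> and \<open>d\<close> are the letters at \<open>u\<close> and \<open>v\<close> and
  \<open>\<sigma>(t)\<close> is the block containing \<open>c\<close>, its cyclic difference is
  \<open>\<delta>(c + 1) - \<delta>(t) + \<delta>(t + d - c - (v - u)) - \<delta>(d)\<close>.

  Since every pair of letters occurs at every positive distance, \<open>c\<close>, \<open>d\<close> and \<open>t\<close> are arbitrary.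
  The word \<open>x\<close> determines \<open>c\<close> unless it is empty, and \<open>y\<close> determines \<open>d\<close> unless it is empty. Hence a
  residue of \<open>p\<close> modulo \<open>K\<close> for which neither is empty contributes \<open>m + m(m - 1)m\<close> classes, a residue
  for which exactly one is empty contributes \<open>m(1 + m(m - 1)/2)\<close>, and if both are empty the cyclic
  differences are those of the factors of length \<open>m + \<nu>\<close>.
\<close>

section \<open>Parikh vectors and cyclic differences\<close>

definition residue_indicator :: "nat \<Rightarrow> int \<Rightarrow> int \<Rightarrow> int" ("\<delta>") where
  "\<delta> m a z = of_bool ([z = a] (mod int m))"

lemma residue_indicator_cong: "[a = b] (mod int m) \<Longrightarrow> \<delta> m a = \<delta> m b"
  by (auto simp: residue_indicator_def cong_def fun_eq_iff)

lemma residue_indicator_commute: "\<delta> m a b = \<delta> m b a"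
  by (simp add: residue_indicator_def cong_sym_eq)

lemma residue_indicator_diff: "\<delta> m (a + c) z = \<delta> m a (z - c)"
  using cong_add_rcancel[of "z - c" c a "int m"] by (simp add: residue_indicator_def)

lemma residue_indicator_of_nat: "a < m \<Longrightarrow> b < m \<Longrightarrow> \<delta> m (int a) (int b) = of_bool (a = b)"
  by (auto simp: residue_indicator_def cong_int_iff dest: cong_less_modulus_unique_nat)

lemma sum_residue_indicator:
  assumes "m > 0"
  shows "(\<Sum>a<m. \<delta> m (int a) z) = 1"
proof -
  have "(\<Sum>a<m. \<delta> m (int a) z) = (\<Sum>a<m. of_bool (nat (z mod int m) = a))"
    by (intro sum.cong) (auto simp: residue_indicator_def cong_def nat_eq_iff)
  also have "\<dots> = 1"
    using assms by (simp add: of_bool_def nat_less_iff)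
  finally show ?thesis .
qed

definition parikh :: "nat \<Rightarrow> nat list \<Rightarrow> int \<Rightarrow> int" where
  "parikh m w = (\<Sum>a\<leftarrow>w. \<delta> m (int a))"

lemma parikh_Nil: "parikh m [] = 0"
  by (simp add: parikh_def)

lemma parikh_Cons: "parikh m (a # w) = \<delta> m (int a) + parikh m w"
  by (simp add: parikh_def)

lemma parikh_append: "parikh m (u @ v) = parikh m u + parikh m v"
  by (simp add: parikh_def)

lemma parikh_sigma:
  assumes "m > 0"
  shows "parikh m (sigma m w) z = int (length w)"
proof (induction w)
  case (Cons a w)
  have "\<delta> m (int ((a + j) mod m)) z = \<delta> m (int j) (z - int a)" for j
  proof -
    have "\<delta> m (int ((a + j) mod m)) = \<delta> m (int j + int a)"
      by (rule residue_indicator_cong) (simp add: cong_def zmod_int add.commute)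
    then show ?thesis by (simp add: residue_indicator_diff)
  qed
  moreover have "parikh m (sigma_letter m a) z = (\<Sum>j<n. \<delta> m (int ((a + j) mod m)) z)"
    if "sigma_letter m a = map (\<lambda>j. (a + j) mod m) [0..<n]" for n
    unfolding that by (induction n) (simp_all add: parikh_Nil parikh_Cons parikh_append)
  ultimately have "parikh m (sigma_letter m a) z = 1"
    using sum_residue_indicator[OF assms] by (simp add: sigma_letter_def)
  then show ?case
    using Cons by (simp add: sigma_def parikh_append)
qed (simp add: sigma_def parikh_Nil)

lemma parikh_eq_count:
  "w \<in> words m \<Longrightarrow> a < m \<Longrightarrow> parikh m w (int a) = int (count (mset w) a)"
  by (induction w) (auto simp: words_def parikh_Nil parikh_Cons residue_indicator_of_nat)

lemma sum_parikh:
  assumes "m > 0"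
  shows "(\<Sum>a<m. parikh m w (int a)) = int (length w)"
proof (induction w)
  case (Cons b w)
  then show ?case
    using sum_residue_indicator[OF assms, of "int b"]
    by (simp add: parikh_Cons sum.distrib residue_indicator_commute[of m "int b"])
qed (simp add: parikh_Nil)

lemma abelian_equiv_iff_parikh:
  assumes "u \<in> words m" "v \<in> words m"
  shows "abelian_equiv u v \<longleftrightarrow> parikh m u = parikh m v"
proof
  assume "abelian_equiv u v"
  then have "(\<Sum>a\<in>#mset u. \<delta> m (int a)) = (\<Sum>a\<in>#mset v. \<delta> m (int a))"
    by (simp only: abelian_equiv_def)
  then show "parikh m u = parikh m v"
    by (simp only: parikh_def sum_mset_sum_list flip: mset_map)
next
  assume eq: "parikh m u = parikh m v"
  have "count (mset u) a = count (mset v) a" for a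
  proof (cases "a < m")
    case True
    then show ?thesis using eq assms by (simp flip: parikh_eq_count of_nat_eq_iff[where 'a = int])
  next
    case False
    then have "a \<notin> set u" "a \<notin> set v" using assms by (auto simp: words_def)
    then show ?thesis by (metis count_mset_0_iff)
  qed
  then show "abelian_equiv u v"
    unfolding abelian_equiv_def by (intro multiset_eqI)
qed

definition cyc_diff :: "nat \<Rightarrow> nat list \<Rightarrow> int \<Rightarrow> int" where
  "cyc_diff m w z = parikh m w z - parikh m w (z - 1)"

lemma cyc_diff_Nil: "cyc_diff m [] = 0"
  by (simp add: cyc_diff_def parikh_Nil fun_eq_iff)

lemma cyc_diff_letter: "cyc_diff m [a] = \<delta> m (int a) - \<delta> m (int a + 1)"
  by (simp add: cyc_diff_def parikh_Cons parikh_Nil residue_indicator_diff fun_eq_iff)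

lemma cyc_diff_append: "cyc_diff m (u @ v) = cyc_diff m u + cyc_diff m v"
  by (simp add: cyc_diff_def parikh_append fun_eq_iff)

lemma cyc_diff_eq_iff:
  "cyc_diff m u = cyc_diff m v \<longleftrightarrow> (\<exists>c. \<forall>z. parikh m u z = parikh m v z + c)"
proof
  assume eq: "cyc_diff m u = cyc_diff m v"
  define f where "f z = parikh m u z - parikh m v z" for z
  have step: "f z = f (z - 1)" for z
    using fun_cong[OF eq, of z] by (simp add: cyc_diff_def f_def)
  have "f z = f 0" for z
  proof (induction z rule: int_induct[of _ 0])
    case (step1 i)
    then show ?case using step[of "i + 1"] by simp
  next
    case (step2 i)
    then show ?case using step[of i] by simp
  qed simp
  then have "\<forall>z. parikh m u z = parikh m v z + f 0"
    by (simp add: f_def algebra_simps)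
  then show "\<exists>c. \<forall>z. parikh m u z = parikh m v z + c" ..
qed (auto simp: cyc_diff_def fun_eq_iff)

lemma length_eq_of_parikh_eq_add:
  assumes "m > 0" "\<And>z. parikh m u z = parikh m v z + c"
  shows "int (length u) = int (length v) + int m * c"
  using sum_parikh[OF assms(1), of u] sum_parikh[OF assms(1), of v] assms(2)
  by (simp add: sum.distrib)

lemma words_append: "u \<in> words m \<Longrightarrow> v \<in> words m \<Longrightarrow> u @ v \<in> words m"
  by (simp add: words_def)

lemma sigma_in_words: "m > 0 \<Longrightarrow> sigma m w \<in> words m"
  by (auto simp: words_def sigma_def sigma_letter_def)

lemma abelian_equiv_iff_cyc_diff:
  assumes "m > 0" "u \<in> words m" "v \<in> words m" "length u = length v"
  shows "abelian_equiv u v \<longleftrightarrow> cyc_diff m u = cyc_diff m v"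
proof
  assume "cyc_diff m u = cyc_diff m v"
  then obtain c where c: "\<And>z. parikh m u z = parikh m v z + c"
    by (auto simp: cyc_diff_eq_iff)
  then have "c = 0"
    using length_eq_of_parikh_eq_add[OF assms(1) c] assms(1,4) by simp
  then show "abelian_equiv u v"
    using c assms(2,3) by (simp add: abelian_equiv_iff_parikh[of _ m] fun_eq_iff)
qed (use assms in \<open>simp add: abelian_equiv_iff_parikh[of _ m] cyc_diff_def fun_eq_iff\<close>)

lemma abelian_equiv_up_to_sigma_iff_cyc_diff:
  assumes "m > 0" "u \<in> words m" "v \<in> words m" "length u < 2 * m" "length v < 2 * m"
  shows "abelian_equiv u v \<or> abelian_equiv u (v @ sigma m [0]) \<or> abelian_equiv (u @ sigma m [0]) v
    \<longleftrightarrow> cyc_diff m u = cyc_diff m v" (is "?equiv \<longleftrightarrow> _")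
proof -
  note words = assms(2,3) words_append[OF _ sigma_in_words[OF assms(1)]]
  have equiv_iff: "?equiv \<longleftrightarrow> (\<exists>c\<in>{-1, 0, 1}. \<forall>z. parikh m u z = parikh m v z + c)"
    using assms(1)
    by (auto simp: abelian_equiv_iff_parikh[of _ m] words parikh_append parikh_sigma fun_eq_iff
        algebra_simps)
  have "c \<in> {-1, 0, 1}" if c: "\<And>z. parikh m u z = parikh m v z + c" for c
  proof -
    have "int m * c < int m * 2" "int m * (-2) < int m * c"
      using length_eq_of_parikh_eq_add[OF assms(1) c] assms(4,5) by linarith+
    then have "c < 2" "-2 < c"
      using assms(1) by (auto simp only: mult_less_cancel_left)
    then show ?thesis by auto
  qed
  then show ?thesis
    unfolding equiv_iff cyc_diff_eq_iff by blast
qed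

section \<open>The word as a digit sum\<close>

lemma nth_sigma:
  assumes "q < length w" "r < m"
  shows "sigma m w ! (m * q + r) = (w ! q + r) mod m"
  using assms
proof (induction w arbitrary: q)
  case (Cons a w)
  have sigma_Cons: "sigma m (a # w) = sigma_letter m a @ sigma m w"
    by (simp add: sigma_def)
  show ?case
    using Cons by (cases q) (simp_all add: sigma_Cons nth_append sigma_letter_def)
qed simp

lemma sigma_inject:
  assumes "m > 0" "u \<in> words m" "v \<in> words m" "sigma m u = sigma m v"
  shows "u = v"
proof (rule nth_equalityI)
  show len: "length u = length v"
    using arg_cong[OF assms(4), of length] assms(1) by (simp add: length_sigma)
  fix i assume i: "i < length u"
  then have "u ! i mod m = v ! i mod m"
    using nth_sigma[of i u 0 m] nth_sigma[of i v 0 m] assms(1,4) len by simp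
  moreover have "u ! i < m" "v ! i < m"
    using assms(2,3) i len by (auto simp: words_def in_lists_conv_set)
  ultimately show "u ! i = v ! i" by simp
qed

lemma sigma_pow_Suc: "sigma_pow m (Suc k) w = sigma m (sigma_pow m k w)"
  by (simp add: sigma_pow_def)

lemma sigma_pow_append: "sigma_pow m k (u @ v) = sigma_pow m k u @ sigma_pow m k v"
  by (induction k) (simp_all add: sigma_pow_def sigma_append)

lemma sigma_pow_inject:
  assumes "m > 0" "u \<in> words m" "v \<in> words m" "sigma_pow m k u = sigma_pow m k v"
  shows "u = v"
  using assms(4)
proof (induction k)
  case (Suc k)
  have "sigma_pow m k w \<in> words m" if "w \<in> words m" for w
    using that sigma_in_words[OF assms(1)] by (cases k) (simp_all add: sigma_pow_def)
  then show ?case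
    using Suc assms(1-3) sigma_inject by (simp add: sigma_pow_Suc)
qed (simp add: sigma_pow_def)

lemma add_mult_unique:
  fixes K a b r s :: nat
  assumes "K * a + r = K * b + s" "r < K" "s < K"
  shows "a = b" "r = s"
proof -
  have "a = (K * a + r) div K" using assms(2) by simp
  also have "\<dots> = b" unfolding assms(1) using assms(3) by simp
  finally show "a = b" .
  then show "r = s" using assms(1) by simp
qed

lemma
  assumes "m > 0" "u \<in> words m" "v \<in> words m" "length x < m ^ k" "length y < m ^ k"
  shows append_sigma_pow_inject: "x @ sigma_pow m k u = y @ sigma_pow m k v \<Longrightarrow> x = y \<and> u = v"
    and sigma_pow_append_inject: "sigma_pow m k u @ x = sigma_pow m k v @ y \<Longrightarrow> x = y \<and> u = v"
proof -
  have len: "length x = length y" "length u = length v"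
    if "m ^ k * length u + length x = m ^ k * length v + length y"
    using add_mult_unique[OF that assms(4,5)] by simp_all
  show "x = y \<and> u = v" if eq: "x @ sigma_pow m k u = y @ sigma_pow m k v"
  proof -
    have "length x = length y"
      using arg_cong[OF eq, of length] by (intro len) (simp add: length_sigma_pow)
    then show ?thesis using eq sigma_pow_inject[OF assms(1-3)] by auto
  qed
  show "x = y \<and> u = v" if eq: "sigma_pow m k u @ x = sigma_pow m k v @ y"
  proof -
    have "length u = length v"
      using arg_cong[OF eq, of length] by (intro len) (simp add: length_sigma_pow)
    then show ?thesis using eq sigma_pow_inject[OF assms(1-3)] by (auto simp: length_sigma_pow)
  qed
qed

locale thue_morse =
  fixes m :: nat
  assumes two_le_m: "2 \<le> m"
begin

lemma m_pos: "0 < m"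
  using two_le_m by simp

abbreviation slice :: "nat \<Rightarrow> nat \<Rightarrow> nat list" where
  "slice a b \<equiv> map (tm m) [a..<b]"

lemma tm_mult_add:
  assumes "r < m"
  shows "tm m (m * q + r) = (tm m q + r) mod m"
proof -
  have q: "q < m ^ q" using two_le_m power_gt_expt[of m q] by simp
  then have "m * Suc q \<le> m * m ^ q" by (intro mult_le_mono) auto
  then have "m * q + r < m ^ Suc q" using assms by simp
  then show ?thesis
    using two_le_m q assms nth_sigma[of q "sigma_pow m q [0]" r m]
    by (simp add: tm_is_limit[of m _ "Suc q"] tm_is_limit[of m q q] sigma_pow_Suc length_sigma_pow)
qed

lemma tm_eq: "tm m i = (tm m (i div m) + i mod m) mod m"
  using tm_mult_add[of "i mod m" "i div m"] m_pos by simp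

lemma tm_less: "tm m i < m"
  by (subst tm_eq) (simp add: m_pos)

lemma tm_0: "tm m 0 = 0"
  by (simp add: tm_def sigma_pow_def)

lemma tm_small: "r < m \<Longrightarrow> tm m r = r"
  using tm_mult_add[of r 0] by (simp add: tm_0)

lemma tm_mult: "tm m (m * q) = tm m q"
  using tm_mult_add[of 0 q] by (simp add: m_pos tm_less)

lemma tm_power_mult_add:
  "r < m ^ k \<Longrightarrow> tm m (m ^ k * q + r) = (tm m q + tm m r) mod m"
proof (induction k arbitrary: r)
  case 0
  then show ?case by (simp add: tm_0 tm_less)
next
  case (Suc k)
  then have "r div m < m ^ k"
    by (simp add: less_mult_imp_div_less mult.commute)
  then have "tm m (m * (m ^ k * q + r div m) + r mod m) =
      ((tm m q + tm m (r div m)) mod m + r mod m) mod m"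
    using Suc.IH m_pos by (simp add: tm_mult_add)
  also have "\<dots> = (tm m q + (tm m (r div m) + r mod m) mod m) mod m"
    by (simp add: mod_simps add.assoc)
  also have "(tm m (r div m) + r mod m) mod m = tm m r"
    by (rule tm_eq[symmetric])
  finally show ?case
    by (simp add: algebra_simps)
qed

lemma tm_cong: "[tm m i = tm m (i div m) + i] (mod m)"
  by (subst tm_eq) (simp add: cong_def mod_simps)

lemma tm_Suc_cong:
  assumes "\<not> m dvd Suc i"
  shows "[tm m (Suc i) = Suc (tm m i)] (mod m)"
proof -
  have "Suc i div m = i div m"
    using assms by (simp add: div_Suc dvd_eq_mod_eq_0)
  then have "[tm m (Suc i) = tm m (i div m) + i + 1] (mod m)"
    using tm_cong[of "Suc i"] by simp
  also have "[tm m (i div m) + i + 1 = tm m i + 1] (mod m)"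
    by (intro cong_add cong_sym[OF tm_cong] cong_refl)
  finally show ?thesis by simp
qed

lemma Suc_tm_cong_div:
  assumes "m dvd Suc i"
  shows "[Suc (tm m i) = tm m (i div m)] (mod m)"
proof -
  have "[tm m i + 1 = tm m (i div m) + i + 1] (mod m)"
    by (intro cong_add tm_cong cong_refl)
  also have "[tm m (i div m) + i + 1 = tm m (i div m)] (mod m)"
    using assms cong_add_lcancel_0_nat[of _ "Suc i"] by (simp add: cong_0_iff)
  finally show ?thesis by simp
qed

lemma slice_in_words: "slice a b \<in> words m"
  by (auto simp: words_def tm_less)

lemma slice_append: "a \<le> b \<Longrightarrow> b \<le> c \<Longrightarrow> slice a b @ slice b c = slice a c"
  by (metis le_iff_add map_append upt_add_eq_append)

lemma sigma_slice: "sigma m (slice a b) = slice (m * a) (m * b)"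
proof (rule nth_equalityI)
  show "length (sigma m (slice a b)) = length (slice (m * a) (m * b))"
    by (simp add: length_sigma diff_mult_distrib2)
next
  fix i assume "i < length (sigma m (slice a b))"
  then have i: "i < m * (b - a)" by (simp add: length_sigma)
  then have q: "i div m < b - a" by (simp add: less_mult_imp_div_less mult.commute)
  have "sigma m (slice a b) ! (m * (i div m) + i mod m) = (tm m (a + i div m) + i mod m) mod m"
    using q m_pos by (subst nth_sigma) auto
  also have "\<dots> = tm m (m * (a + i div m) + i mod m)"
    using m_pos by (simp only: tm_mult_add mod_less_divisor)
  also have "m * (a + i div m) + i mod m = m * a + i"
    by (simp add: algebra_simps)
  finally show "sigma m (slice a b) ! i = slice (m * a) (m * b) ! i"
    using i by (simp add: diff_mult_distrib2)
qed

lemma sigma_pow_slice: "sigma_pow m k (slice a b) = slice (m ^ k * a) (m ^ k * b)"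
  by (induction k) (simp_all add: sigma_pow_def sigma_slice mult.assoc)

lemma cyc_diff_slice:
  assumes "a \<le> b"
  shows "cyc_diff m (slice a b) =
    (\<delta> m (int (tm m (b div m))) - \<delta> m (int (tm m b))) -
    (\<delta> m (int (tm m (a div m))) - \<delta> m (int (tm m a)))"
  using assms
proof (induction b rule: dec_induct)
  case base
  then show ?case by (simp add: cyc_diff_Nil)
next
  case (step b)
  have "\<delta> m (int (tm m (Suc b div m))) - \<delta> m (int (tm m (Suc b))) =
      \<delta> m (int (tm m (b div m))) - \<delta> m (int (tm m b) + 1)"
  proof (cases "m dvd Suc b")
    case True
    then have "tm m (Suc b) = tm m (Suc b div m)" by (metis tm_mult dvd_mult_div_cancel)
    moreover have "\<delta> m (int (tm m b) + 1) = \<delta> m (int (tm m (b div m)))"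
      using Suc_tm_cong_div[OF True]
      by (intro residue_indicator_cong) (simp add: add.commute flip: cong_int_iff)
    ultimately show ?thesis by simp
  next
    case False
    then have "Suc b div m = b div m" by (simp add: div_Suc dvd_eq_mod_eq_0)
    moreover have "\<delta> m (int (tm m (Suc b))) = \<delta> m (int (tm m b) + 1)"
      using tm_Suc_cong[OF False]
      by (intro residue_indicator_cong) (simp add: add.commute flip: cong_int_iff)
    ultimately show ?thesis by simp
  qed
  then show ?case
    using step by (simp add: cyc_diff_append cyc_diff_letter fun_eq_iff)
qed

text \<open>Appending the digit \<open>m - 1\<close> to \<open>i\<close> puts one more carry into the step from \<open>i\<close> to \<open>i + 1\<close>, which
  raises the difference of the digit sums by one modulo \<open>m\<close>.\<close>

lemma ex_tm_Suc_gap: "\<exists>i. [tm m (Suc i) = tm m i + Suc c] (mod m)"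
proof (induction c)
  case 0
  have "[tm m (Suc 0) = tm m 0 + Suc 0] (mod m)"
    using two_le_m by (simp add: tm_0 tm_small)
  then show ?case ..
next
  case (Suc c)
  then obtain i where i: "[tm m (Suc i) = tm m i + Suc c] (mod m)" ..
  define j where "j = m * i + (m - 1)"
  have "[tm m j = tm m i + (m - 1)] (mod m)"
    using tm_mult_add[of "m - 1" i] m_pos by (simp add: j_def cong_def)
  then have "[tm m j + Suc (Suc c) = tm m i + (m - 1) + Suc (Suc c)] (mod m)"
    by (intro cong_add cong_refl)
  also have "tm m i + (m - 1) + Suc (Suc c) = tm m i + Suc c + m"
    using m_pos by simp
  also have "[tm m i + Suc c + m = tm m i + Suc c] (mod m)"
    by (simp only: cong_def mod_add_self2)
  also have "[tm m i + Suc c = tm m (m * Suc i)] (mod m)"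
    unfolding tm_mult by (rule cong_sym[OF i])
  also have "m * Suc i = Suc j"
    using m_pos by (simp add: j_def)
  finally show ?case by (blast intro: cong_sym)
qed

lemma ex_tm_gap_less:
  assumes "1 \<le> d" "d < m"
  shows "\<exists>i. [tm m (i + d) = tm m i + c] (mod m)"
proof -
  obtain j where j: "[tm m (Suc j) = tm m j + Suc (c + (m - 1 - d))] (mod m)"
    using ex_tm_Suc_gap by blast
  define i where "i = m * j + (m - 1)"
  have "i + d = m * Suc j + (d - 1)"
    using m_pos assms(1) by (simp add: i_def)
  then have "[tm m (i + d) = tm m (Suc j) + (d - 1)] (mod m)"
    using assms tm_mult_add[of "d - 1" "Suc j"] by (simp add: cong_def)
  also have "[tm m (Suc j) + (d - 1) = tm m j + Suc (c + (m - 1 - d)) + (d - 1)] (mod m)"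
    by (intro cong_add j cong_refl)
  also have "tm m j + Suc (c + (m - 1 - d)) + (d - 1) = tm m j + (m - 1) + c"
    using assms by simp
  also have "[tm m j + (m - 1) + c = tm m i + c] (mod m)"
    using tm_mult_add[of "m - 1" j] m_pos by (simp add: i_def cong_def mod_simps)
  finally show ?thesis ..
qed

lemma ex_tm_gap: "1 \<le> d \<Longrightarrow> \<exists>i. [tm m (i + d) = tm m i + c] (mod m)"
proof (induction d arbitrary: c rule: less_induct)
  case (less d)
  show ?case
  proof (cases "d < m")
    case True
    then show ?thesis using less.prems by (intro ex_tm_gap_less)
  next
    case False
    define q r where "q = d div m" and "r = d mod m"
    have d: "d = m * q + r" and r: "r < m" using m_pos by (simp_all add: q_def r_def)
    have "1 \<le> q" "q < d"
      using False two_le_m by (simp_all add: q_def div_greater_zero_iff Suc_le_eq)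
    then obtain j where j: "[tm m (j + q) = tm m j + (c + (m - r))] (mod m)"
      using less.IH by blast
    have "[tm m (m * j + d) = tm m (j + q) + r] (mod m)"
      using tm_mult_add[OF r, of "j + q"] by (simp add: d cong_def algebra_simps)
    also have "[tm m (j + q) + r = tm m j + (c + (m - r)) + r] (mod m)"
      by (intro cong_add j cong_refl)
    also have "tm m j + (c + (m - r)) + r = tm m j + c + m"
      using r by simp
    also have "[tm m j + c + m = tm m (m * j) + c] (mod m)"
      by (simp add: cong_def tm_mult)
    finally show ?thesis ..
  qed
qed

lemma ex_tm_pair:
  assumes "d \<ge> 1" "a < m" "b < m"
  shows "\<exists>i. tm m i = a \<and> tm m (i + d) = b"
proof -
  obtain i where i: "[tm m (i + d) = tm m i + (b + (m - a))] (mod m)"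
    using ex_tm_gap[OF assms(1)] by blast
  define c where "c = (a + (m - tm m i)) mod m"
  have less: "i + d < m ^ (i + d)"
    using power_gt_expt two_le_m by simp
  then have shift: "[tm m (m ^ (i + d) * c + l) = tm m l + (a + (m - tm m i))] (mod m)"
    if "l \<le> i + d" for l
  proof -
    have "tm m (m ^ (i + d) * c + l) = (c + tm m l) mod m"
      using tm_power_mult_add[of l "i + d" c] that less m_pos by (simp add: tm_small c_def)
    then show ?thesis
      by (simp add: c_def cong_def mod_simps add.commute)
  qed
  let ?i = "m ^ (i + d) * c + i"
  have "[tm m ?i = a] (mod m)"
    using shift[of i] tm_less[of i] by (simp add: cong_def)
  moreover have "[tm m (?i + d) = b] (mod m)"
  proof -
    have "[tm m (?i + d) = tm m (i + d) + (a + (m - tm m i))] (mod m)"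
      using shift[of "i + d"] by (simp add: add.assoc)
    also have "[tm m (i + d) + (a + (m - tm m i)) =
        tm m i + (b + (m - a)) + (a + (m - tm m i))] (mod m)"
      by (intro cong_add i cong_refl)
    also have "tm m i + (b + (m - a)) + (a + (m - tm m i)) = b + 2 * m"
      using assms(2) tm_less[of i] by simp
    also have "[b + 2 * m = b] (mod m)"
      by (simp add: cong_def)
    finally show ?thesis .
  qed
  ultimately show ?thesis
    using assms(2,3) tm_less cong_less_modulus_unique_nat by blast
qed

lemma slice_recurrent: "\<exists>j\<ge>b. slice i (i + n) = slice j (j + n)"
proof -
  obtain q where q: "tm m (q + Suc b) = 0"
    using ex_tm_pair[of "Suc b" 0 0] m_pos by auto
  define N where "N = m ^ (i + n)"
  have N: "i + n < N"
    using power_gt_expt two_le_m by (simp add: N_def)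
  define j where "j = N * (q + Suc b) + i"
  have "tm m (i + l) = tm m (j + l)" if "l < n" for l
    using that N q tm_less tm_power_mult_add[of "i + l" "i + n" "q + Suc b"]
    by (simp add: j_def N_def add.assoc)
  then have "slice i (i + n) = slice j (j + n)"
    by (intro nth_equalityI) simp_all
  moreover have "b \<le> j"
    using N mult_le_mono1[of 1 N "q + Suc b"] by (simp add: j_def)
  ultimately show ?thesis by blast
qed

lemma factors_eq_range_slice: "factors m n = range (\<lambda>p. slice (Suc p) (p + Suc n))"
proof (intro equalityI subsetI)
  fix U assume "U \<in> factors m n"
  then obtain i where "U = slice i (i + n)"
    by (auto simp: factors_def is_factor_def)
  then obtain j where "j \<ge> 1" "U = slice j (j + n)"
    using slice_recurrent[where b = 1] by auto
  then have "U = slice (Suc (j - 1)) (j - 1 + Suc n)" by simp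
  then show "U \<in> range (\<lambda>p. slice (Suc p) (p + Suc n))" by blast
next
  fix U assume "U \<in> range (\<lambda>p. slice (Suc p) (p + Suc n))"
  then obtain p where p: "U = slice (Suc p) (Suc p + n)" by auto
  then have "length U = n" by simp
  with p have "U = slice (Suc p) (Suc p + length U)" by (simp only:)
  with \<open>length U = n\<close> show "U \<in> factors m n"
    unfolding factors_def is_factor_def by blast
qed

end

section \<open>Synchronization and borders\<close>

lemma map_upt_infix:
  assumes "xs @ ys @ zs = map f [a..<b]"
  shows "ys = map f [a + length xs..<a + length xs + length ys]"
proof -
  have "ys = take (length ys) (drop (length xs) (map f [a..<b]))"
    unfolding assms[symmetric] by simp
  moreover have "a + length xs + length ys \<le> b" if "ys \<noteq> []"
    using arg_cong[OF assms, of length] that by (cases ys) auto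
  ultimately show ?thesis
    by (cases "ys = []") (simp_all add: take_map drop_map take_upt)
qed

lemma length_proper_suffix_less: "proper_suffix x w \<Longrightarrow> length w \<le> n \<Longrightarrow> 0 < n \<Longrightarrow> length x < n"
  by (auto simp: proper_suffix_def dest: suffix_length_less)

lemma length_proper_prefix_less: "proper_prefix y w \<Longrightarrow> length w \<le> n \<Longrightarrow> 0 < n \<Longrightarrow> length y < n"
  by (auto simp: proper_prefix_def dest: prefix_length_less)

context thue_morse
begin

lemma tm_mult_not_cong_Suc:
  assumes "Suc i = m * q" "\<not> m dvd q"
  shows "\<not> [tm m (Suc i) = Suc (tm m i)] (mod m)"
proof
  assume "[tm m (Suc i) = Suc (tm m i)] (mod m)"
  also have "[Suc (tm m i) = tm m (i div m)] (mod m)"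
    using assms(1) by (intro Suc_tm_cong_div) simp
  finally have cong: "[tm m q = tm m (i div m)] (mod m)"
    by (simp add: assms(1) tm_mult)
  obtain r where q: "q = Suc r"
    using assms(2) by (cases q) auto
  moreover have "i div m = r"
    using assms(1) m_pos unfolding q by (intro div_nat_eqI) auto
  ultimately have "[tm m r = Suc (tm m r)] (mod m)"
    using cong tm_Suc_cong[of r] assms(2) by (metis cong_sym cong_trans)
  then have "[1 = 0] (mod m)"
    using cong_add_lcancel_0_nat[of "tm m r" 1 m] by (simp add: cong_sym_eq)
  then show False
    using two_le_m by (simp add: cong_def)
qed

text \<open>Of two consecutive multiples of \<open>m\<close> at least one is not a multiple of \<open>m\<^sup>2\<close>, and there the cyclic
  succession of the letters breaks.\<close>

lemma ex_tm_not_cong_Suc: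
  assumes "\<not> m dvd P"
  obtains l where "Suc l < 2 * m" "\<not> [tm m (P + Suc l) = Suc (tm m (P + l))] (mod m)"
proof -
  define q where "q = P div m"
  have "m * q \<noteq> P" using assms by (metis dvd_triv_left)
  then have P: "m * q < P" "P < m * (q + 1)"
    using m_pos dividend_less_times_div[of m P] by (simp_all add: q_def le_neq_implies_less)
  obtain h where h: "h \<in> {q + 1, q + 2}" "\<not> m dvd h"
    using two_le_m dvd_diff_nat[of m "q + 2" "q + 1"] by auto
  define l where "l = m * h - P - 1"
  have "m * (q + 1) \<le> m * h" "m * h \<le> m * (q + 2)"
    using h(1) by (auto intro: mult_le_mono2)
  then have l: "Suc (P + l) = m * h" "Suc l < 2 * m"
    using P by (auto simp: l_def algebra_simps)
  show thesis
    using tm_mult_not_cong_Suc[OF l(1) h(2)] l(2) by (intro that[of l]) simp_all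
qed

lemma tm_synchronized_mod_m:
  assumes "\<And>l. l < 2 * m \<Longrightarrow> tm m (P + l) = tm m (P' + l)"
  shows "[P = P'] (mod m)"
proof -
  have sync: "[P = P'] (mod m)"
    if eq: "\<And>l. l < 2 * m \<Longrightarrow> tm m (P + l) = tm m (P' + l)" and "\<not> m dvd P" for P P'
  proof -
    obtain l where l: "Suc l < 2 * m" "\<not> [tm m (P + Suc l) = Suc (tm m (P + l))] (mod m)"
      using ex_tm_not_cong_Suc[OF \<open>\<not> m dvd P\<close>] .
    then have "\<not> [tm m (P' + Suc l) = Suc (tm m (P' + l))] (mod m)"
      using eq[of l] eq[of "Suc l"] by simp
    with l(2) have "m dvd P + Suc l" "m dvd P' + Suc l"
      using tm_Suc_cong by auto
    then have "[P + Suc l = P' + Suc l] (mod m)"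
      by (simp add: cong_def dvd_eq_mod_eq_0)
    then show ?thesis by (simp only: cong_add_rcancel_nat)
  qed
  show ?thesis
  proof (cases "m dvd P \<and> m dvd P'")
    case True
    then show ?thesis by (simp add: cong_def dvd_eq_mod_eq_0)
  next
    case False
    then show ?thesis using sync[of P P'] sync[of P' P] assms by (metis cong_sym)
  qed
qed

lemma tm_synchronized:
  assumes "\<And>l. l < 2 * m ^ k \<Longrightarrow> tm m (P + l) = tm m (P' + l)"
  shows "[P = P'] (mod m ^ k)"
  using assms
proof (induction k arbitrary: P P')
  case (Suc k)
  define Q Q' r where "Q = P div m" and "Q' = P' div m" and "r = P mod m"
  have "2 * m \<le> 2 * m ^ Suc k" using m_pos by simp
  then have "[P = P'] (mod m)"
    using Suc.prems less_le_trans by (intro tm_synchronized_mod_m) blast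
  then have r: "r < m" "P' mod m = r"
    using m_pos by (simp_all add: r_def cong_def)
  have P: "P = m * Q + r" and P': "P' = m * Q' + r"
    using mult_div_mod_eq[of m P'] r(2) by (simp_all add: Q_def Q'_def r_def)
  have "tm m (Q + l) = tm m (Q' + l)" if "l < 2 * m ^ k" for l
  proof -
    have "m * l < 2 * m ^ Suc k" using that m_pos by simp
    then have "tm m (m * (Q + l) + r) = tm m (m * (Q' + l) + r)"
      using Suc.prems[of "m * l"] by (simp add: P P' algebra_simps)
    then have "[tm m (Q + l) + r = tm m (Q' + l) + r] (mod m)"
      using r(1) by (simp add: tm_mult_add cong_def)
    then show ?thesis
      using tm_less cong_less_modulus_unique_nat by (simp add: cong_add_rcancel_nat)
  qed
  then have "[m * Q = m * Q'] (mod m * m ^ k)"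
    by (intro cong_cmult_leftI Suc.IH)
  then show ?case by (simp add: P P' cong_add_rcancel_nat)
qed simp

lemma sigma_factorization_occursE:
  assumes "sigma_factorization m k U x u y"
  obtains P Q where "U = slice P (P + length U)" "P + length x = m ^ k * Q"
    "length x < m ^ k" "length y < m ^ k" "u \<in> words m"
proof -
  obtain a b i where U: "U = x @ sigma_pow m k u @ y" and ab: "length a \<le> 1" "length b \<le> 1"
    and i: "a @ u @ b = slice i (i + length (a @ u @ b))"
    and x: "proper_suffix x (sigma_pow m k a)" and y: "proper_prefix y (sigma_pow m k b)"
    using assms unfolding sigma_factorization_def is_factor_def by metis
  obtain x' where x': "sigma_pow m k a = x' @ x"
    using x by (auto simp: proper_suffix_def strict_suffix_def suffix_def)
  obtain y' where y': "sigma_pow m k b = y @ y'"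
    using y by (auto simp: proper_prefix_def strict_prefix_def prefix_def)
  have "x' @ U @ y' = sigma_pow m k (a @ u @ b)"
    by (simp add: sigma_pow_append x' y' U)
  also have "\<dots> = slice (m ^ k * i) (m ^ k * (i + length (a @ u @ b)))"
    by (subst i) (rule sigma_pow_slice)
  finally have "U = slice (m ^ k * i + length x') (m ^ k * i + length x' + length U)"
    by (rule map_upt_infix)
  moreover have "m ^ k * i + length x' + length x = m ^ k * (i + length a)"
    using arg_cong[OF x', of length] by (simp add: length_sigma_pow algebra_simps)
  moreover have "length x < m ^ k" "length y < m ^ k"
    using ab m_pos length_proper_suffix_less[OF x] length_proper_prefix_less[OF y]
    by (simp_all add: length_sigma_pow)
  moreover have "u \<in> words m"
    using slice_in_words[of i "i + length (a @ u @ b)"] unfolding i[symmetric]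
    by (simp add: words_def)
  ultimately show thesis by (rule that)
qed

lemma sigma_factorization_unique:
  assumes "sigma_factorization m k U x u y" "sigma_factorization m k U x' u' y'"
    and "2 * m ^ k \<le> length U"
  shows "x = x' \<and> u = u' \<and> y = y'"
proof -
  obtain P Q where P: "U = slice P (P + length U)" "P + length x = m ^ k * Q"
    and len: "length x < m ^ k" "length y < m ^ k" and u: "u \<in> words m"
    using sigma_factorization_occursE[OF assms(1)] .
  obtain P' Q' where P': "U = slice P' (P' + length U)" "P' + length x' = m ^ k * Q'"
    and len': "length x' < m ^ k" "length y' < m ^ k" and u': "u' \<in> words m"
    using sigma_factorization_occursE[OF assms(2)] .
  have "tm m (P + l) = tm m (P' + l)" if "l < 2 * m ^ k" for l
    using that assms(3) arg_cong[OF P(1), of "\<lambda>w. w ! l"] arg_cong[OF P'(1), of "\<lambda>w. w ! l"]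
    by simp
  then have "[P = P'] (mod m ^ k)" by (rule tm_synchronized)
  then have "[P + length x' = P' + length x'] (mod m ^ k)"
    by (intro cong_add cong_refl)
  also have "[P' + length x' = P + length x] (mod m ^ k)"
    unfolding P(2) P'(2) by (simp add: cong_def)
  finally have "length x = length x'"
    using len len' cong_less_modulus_unique_nat by (metis cong_add_lcancel_nat)
  moreover have "x @ sigma_pow m k u @ y = x' @ sigma_pow m k u' @ y'"
    using assms(1,2) by (auto simp: sigma_factorization_def)
  ultimately show ?thesis
    using sigma_pow_append_inject[OF m_pos u u' len(2) len'(2)] by auto
qed

lemma proper_suffix_slice:
  assumes "a < c" "c \<le> b"
  shows "proper_suffix (slice c b) (slice a b)"
proof -
  have "slice a b = slice a c @ slice c b" "slice a c \<noteq> []"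
    using assms by (simp_all add: slice_append)
  then show ?thesis
    unfolding proper_suffix_def strict_suffix_def suffix_def by (metis append_self_conv2)
qed

lemma proper_prefix_slice:
  assumes "a \<le> c" "c < b"
  shows "proper_prefix (slice a c) (slice a b)"
proof -
  have "slice a b = slice a c @ slice c b" "slice c b \<noteq> []"
    using assms by (simp_all add: slice_append)
  then show ?thesis
    unfolding proper_prefix_def strict_prefix_def prefix_def by (metis append_self_conv)
qed

lemma sigma_factorization_slice:
  assumes "Suc p + m ^ k \<le> E"
  shows "sigma_factorization m k (slice (Suc p) E) (slice (Suc p) (m ^ k * Suc (p div m ^ k)))
    (slice (Suc (p div m ^ k)) (E div m ^ k)) (slice (m ^ k * (E div m ^ k)) E)"
proof -
  define L Q R where "L = m ^ k" and "Q = p div L" and "R = E div L"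
  have L: "0 < L" using m_pos by (simp add: L_def)
  have p: "L * Q < Suc p" "Suc p \<le> L * Suc Q" and E: "L * R \<le> E" "E < L * Suc R"
    using L dividend_less_times_div[of L] by (simp_all add: Q_def R_def Suc_le_eq less_Suc_eq_le)
  have "(p + L) div L \<le> E div L"
    using assms by (intro div_le_mono) (simp add: L_def)
  then have QR: "Suc Q \<le> R" using L by (simp add: Q_def R_def)
  then have mid: "L * Suc Q \<le> L * R" by (rule mult_le_mono2)
  have "slice Q (Suc Q) @ slice (Suc Q) R @ slice R (Suc R) = slice Q (Suc R)"
    using QR by (simp add: slice_append del: upt_Suc)
  then have "is_factor (slice Q (Suc Q) @ slice (Suc Q) R @ slice R (Suc R)) (tm m)"
    using QR unfolding is_factor_def by (intro exI[of _ Q]) (simp del: upt_Suc)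
  moreover have "slice (Suc p) E =
      slice (Suc p) (L * Suc Q) @ sigma_pow m k (slice (Suc Q) R) @ slice (L * R) E"
    using p E mid by (simp add: sigma_pow_slice slice_append flip: L_def)
  moreover have "proper_suffix (slice (Suc p) (L * Suc Q)) (sigma_pow m k (slice Q (Suc Q)))"
    unfolding sigma_pow_slice L_def[symmetric] using p by (rule proper_suffix_slice)
  moreover have "proper_prefix (slice (L * R) E) (sigma_pow m k (slice R (Suc R)))"
    unfolding sigma_pow_slice L_def[symmetric] using E by (rule proper_prefix_slice)
  ultimately show ?thesis
    unfolding sigma_factorization_def L_def[symmetric] Q_def[symmetric] R_def[symmetric]
    by (intro conjI exI[of _ "slice Q (Suc Q)"] exI[of _ "slice R (Suc R)"]) simp_all
qed

lemma border_slice: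
  assumes "Suc p + 2 * m ^ k \<le> E"
  shows "border m k (slice (Suc p) E) =
    (slice (Suc p) (m ^ k * Suc (p div m ^ k)), slice (m ^ k * (E div m ^ k)) E)"
proof -
  have factorization: "sigma_factorization m k (slice (Suc p) E)
      (slice (Suc p) (m ^ k * Suc (p div m ^ k))) (slice (Suc (p div m ^ k)) (E div m ^ k))
      (slice (m ^ k * (E div m ^ k)) E)"
    using assms by (intro sigma_factorization_slice) simp
  have "(THE (x, u, y). sigma_factorization m k (slice (Suc p) E) x u y) =
      (slice (Suc p) (m ^ k * Suc (p div m ^ k)), slice (Suc (p div m ^ k)) (E div m ^ k),
       slice (m ^ k * (E div m ^ k)) E)"
    using assms sigma_factorization_unique[OF _ factorization]
    by (intro the_equality) (auto simp: factorization simp del: mult_Suc_right)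
  then show ?thesis by (simp add: border_def)
qed

end

section \<open>Counting differences of residue indicators\<close>

lemma range_comp_surj: "surj h \<Longrightarrow> range (f \<circ> g \<circ> h) = f ` range g"
  by (simp only: flip: image_comp)

lemma card_range_residue_translates:
  assumes "m > 0"
  shows "card (range (\<lambda>t. \<delta> m (t + a) - \<delta> m t)) = (if [a = 0] (mod int m) then 1 else m)"
    (is "card (range ?f) = _")
proof (cases "[a = 0] (mod int m)")
  case True
  then have "?f t = 0" for t
    using cong_add[OF cong_refl[of t] True] residue_indicator_cong[of "t + a" t] by simp
  then have "range ?f = {0}" by auto
  then show ?thesis using True by simp
next
  case False
  have "?f (t mod int m) = ?f t" for t
    using residue_indicator_cong[of "t mod int m + a" "t + a"]
      residue_indicator_cong[of "t mod int m" t] by (simp add: cong_def mod_simps)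
  then have "?f t \<in> ?f ` {0..<int m}" for t
    using assms by (intro image_eqI[of _ _ "t mod int m"]) simp_all
  then have "range ?f = ?f ` {0..<int m}" by blast
  moreover have "inj_on ?f {0..<int m}"
  proof (rule inj_onI)
    fix s t assume st: "s \<in> {0..<int m}" "t \<in> {0..<int m}" "?f s = ?f t"
    have "\<not> [s + a = s] (mod int m)" using False by (simp add: cong_add_lcancel_0)
    then have "?f t (s + a) = 1"
      using fun_cong[OF st(3), of "s + a"] by (simp add: residue_indicator_def)
    then have "[s = t] (mod int m)"
      by (auto simp: residue_indicator_def of_bool_def cong_add_rcancel split: if_splits)
    then show "s = t" using st by (simp add: cong_def)
  qed
  ultimately show ?thesis using False by (simp add: card_image)
qed

definition residue_defect :: "nat \<Rightarrow> int \<Rightarrow> int \<Rightarrow> int \<Rightarrow> int" where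
  "residue_defect m a b = \<delta> m a + \<delta> m b - \<delta> m (a + b)"

lemma residue_defect_cong:
  assumes "[a = a'] (mod int m)" "[b = b'] (mod int m)"
  shows "residue_defect m a b = residue_defect m a' b'"
  unfolding residue_defect_def
  using residue_indicator_cong[OF assms(1)] residue_indicator_cong[OF assms(2)]
    residue_indicator_cong[OF cong_add[OF assms]] by simp

lemma residue_defect_commute: "residue_defect m a b = residue_defect m b a"
  by (simp add: residue_defect_def add.commute)

lemma residue_defect_0: "residue_defect m a 0 = \<delta> m 0"
  by (simp add: residue_defect_def)

lemma residue_defect_pos_iff:
  assumes "a \<in> {1..<m}" "b \<in> {1..<m}" "c < m"
  shows "residue_defect m (int a) (int b) (int c) > 0 \<longleftrightarrow> c = a \<or> c = b"
proof -
  have "\<not> m dvd a" "\<not> m dvd b" using assms(1,2) by (auto dest: dvd_imp_le)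
  then have "\<delta> m (int a + int b) (int a) = 0" "\<delta> m (int a + int b) (int b) = 0"
    by (simp_all add: residue_indicator_def cong_sym_eq[of "int _" "int _ + int _"]
        cong_add_lcancel_0 cong_add_rcancel_0 cong_0_iff)
  moreover have "0 \<le> \<delta> m (int a + int b) (int c)"
    by (simp add: residue_indicator_def)
  ultimately show ?thesis
    using assms by (auto simp: residue_defect_def residue_indicator_of_nat)
qed

lemma range_residue_defect:
  assumes "m > 0"
  shows "range (\<lambda>(a, b). residue_defect m a b) =
    insert (\<delta> m 0) ((\<lambda>(a, b). residue_defect m (int a) (int b)) ` (SIGMA a:{..<m}. {1..a}))"
    (is "_ = insert _ (?f ` ?T)")
proof (intro equalityI subsetI)
  fix g assume "g \<in> range (\<lambda>(a, b). residue_defect m a b)"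
  then obtain x y where g: "g = residue_defect m x y" by auto
  define a b where "a = nat (x mod int m)" and "b = nat (y mod int m)"
  have less: "a < m" "b < m" using assms by (simp_all add: a_def b_def nat_less_iff)
  have "[x = int a] (mod int m)" "[y = int b] (mod int m)"
    using assms by (simp_all add: a_def b_def cong_def)
  then have ab: "g = residue_defect m (int a) (int b)"
    unfolding g by (rule residue_defect_cong)
  then have ba: "g = residue_defect m (int b) (int a)"
    by (simp only: residue_defect_commute)
  consider (zero) "a = 0 \<or> b = 0" | (ordered) "0 < b" "b \<le> a" | (swapped) "0 < a" "a \<le> b"
    by linarith
  then show "g \<in> insert (\<delta> m 0) (?f ` ?T)"
  proof cases
    case zero
    then show ?thesis using ab ba by (auto simp: residue_defect_0)
  next
    case ordered
    then have "?f (a, b) \<in> ?f ` ?T" using less by (intro imageI) simp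
    then show ?thesis using ab by simp
  next
    case swapped
    then have "?f (b, a) \<in> ?f ` ?T" using less by (intro imageI) simp
    then show ?thesis using ba by simp
  qed
next
  fix g assume "g \<in> insert (\<delta> m 0) (?f ` ?T)"
  then consider "g = residue_defect m 0 0" | a b where "g = residue_defect m (int a) (int b)"
    using residue_defect_0[of m 0] by auto
  then show "g \<in> range (\<lambda>(a, b). residue_defect m a b)"
    by cases auto
qed

lemma sum_lessThan_eq_choose_two: "\<Sum>{..<n} = n choose 2"
  by (induction n) (simp_all add: numeral_2_eq_2)

text \<open>A defect of two nonzero residues is positive exactly at these two residues, so it determines
  the unordered pair; if one of the residues is \<open>0\<close>, it is \<open>\<delta> m 0\<close>.\<close>

lemma card_range_residue_defect:
  assumes "m > 0"
  shows "card (range (\<lambda>(a, b). residue_defect m a b)) = Suc (m choose 2)"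
proof -
  let ?f = "\<lambda>(a, b). residue_defect m (int a) (int b)"
  let ?T = "SIGMA a:{..<m}. {1..a}"
  have supp: "{c. c < m \<and> ?f (a, b) (int c) > 0} = {a, b}" if "(a, b) \<in> ?T" for a b
    using that residue_defect_pos_iff[of a m b] by auto
  have "inj_on ?f ?T"
  proof (rule inj_onI)
    fix x y assume xy: "x \<in> ?T" "y \<in> ?T" "?f x = ?f y"
    obtain a b a' b' where x: "x = (a, b)" and y: "y = (a', b')" by (cases x, cases y)
    have "{a, b} = {a', b'}" using supp[of a b] supp[of a' b'] xy unfolding x y by auto
    then show "x = y" using xy(1,2) by (auto simp: x y doubleton_eq_iff)
  qed
  then have "card (?f ` ?T) = m choose 2"
    by (simp add: card_image sum_lessThan_eq_choose_two)
  moreover have "\<delta> m 0 \<notin> ?f ` ?T"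
  proof
    assume "\<delta> m 0 \<in> ?f ` ?T"
    then obtain a b where ab: "(a, b) \<in> ?T" "\<delta> m 0 = ?f (a, b)" by blast
    then have "\<delta> m 0 (int a) > 0" using supp[OF ab(1)] by auto
    then show False using ab(1) residue_indicator_of_nat[of 0 m a] by simp
  qed
  ultimately show ?thesis
    unfolding range_residue_defect[OF assms] by simp
qed

lemma card_range_shifted_residue_defect:
  assumes "m > 0"
  shows "card (range (\<lambda>(a, b). \<delta> m a + \<delta> m b - \<delta> m (a + b - s))) = Suc (m choose 2)"
    (is "card (range ?f) = _")
proof -
  define shift :: "(int \<Rightarrow> int) \<Rightarrow> int \<Rightarrow> int" where "shift f z = f (z + s)" for f z
  define translate :: "int \<times> int \<Rightarrow> int \<times> int" where "translate = (\<lambda>(a, b). (a + s, b + s))"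
  have "(\<lambda>(a, b). residue_defect m a b) = shift \<circ> ?f \<circ> translate"
    by (simp add: fun_eq_iff shift_def translate_def residue_defect_def residue_indicator_diff)
  moreover have "surj translate"
    by (rule surjI[where f = "\<lambda>(a, b). (a - s, b - s)"]) (auto simp: translate_def)
  ultimately have "range (\<lambda>(a, b). residue_defect m a b) = shift ` range ?f"
    by (simp only: range_comp_surj)
  moreover have "inj shift"
    by (rule inj_on_inverseI[where g = "\<lambda>f z. f (z - s)"]) (simp add: shift_def)
  then have "inj_on shift (range ?f)"
    by (rule inj_on_subset) simp
  ultimately show ?thesis
    using card_range_residue_defect[OF assms] card_image[of shift "range ?f"] by (simp only:)
qed

text \<open>The cyclic difference of the word strictly between two letters \<open>c\<close> and \<open>d\<close> at distance \<open>N\<close>,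
  where \<open>\<sigma>(t)\<close> is the block containing \<open>c\<close>.\<close>

definition gap_diff :: "nat \<Rightarrow> int \<Rightarrow> int \<Rightarrow> int \<Rightarrow> int \<Rightarrow> int \<Rightarrow> int" where
  "gap_diff m N c d t = \<delta> m (c + 1) - \<delta> m t + \<delta> m (t + d - c - N) - \<delta> m d"

lemma gap_diff_cong:
  assumes "[N = N'] (mod int m)" "[c = c'] (mod int m)" "[d = d'] (mod int m)" "[t = t'] (mod int m)"
  shows "gap_diff m N c d t = gap_diff m N' c' d' t'"
proof -
  have "[c + 1 = c' + 1] (mod int m)" "[t + d - c - N = t' + d' - c' - N'] (mod int m)"
    using assms by (auto intro!: cong_add cong_diff)
  then show ?thesis
    using assms(3,4) by (simp add: gap_diff_def residue_indicator_cong[of _ _ m])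
qed

lemma card_range_gap_diff_fixed_ends:
  assumes "m > 0"
  shows "card (range (gap_diff m N c d)) = (if [d = c + N] (mod int m) then 1 else m)"
proof -
  have "gap_diff m N c d t =
      (\<delta> m (c + 1) - \<delta> m d) + (\<delta> m (t + (d - (c + N))) - \<delta> m t)" for t
    by (simp add: gap_diff_def algebra_simps)
  then have "range (gap_diff m N c d) =
      (+) (\<delta> m (c + 1) - \<delta> m d) ` range (\<lambda>t. \<delta> m (t + (d - (c + N))) - \<delta> m t)"
    by (auto simp: image_iff)
  then show ?thesis
    using card_range_residue_translates[OF assms]
    by (simp add: card_image cong_diff_iff_cong_0)
qed

lemma card_range_gap_diff_fixed_left:
  assumes "m > 0"
  shows "card (range (\<lambda>(d, t). gap_diff m N c d t)) = Suc (m choose 2)"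
proof -
  have "gap_diff m N c d t = \<delta> m (c + 1) - (\<delta> m d + \<delta> m t - \<delta> m (d + t - (c + N)))" for d t
    by (simp add: gap_diff_def algebra_simps)
  then have "range (\<lambda>(d, t). gap_diff m N c d t) =
      (-) (\<delta> m (c + 1)) ` range (\<lambda>(a, b). \<delta> m a + \<delta> m b - \<delta> m (a + b - (c + N)))"
    by (auto simp: image_iff)
  then show ?thesis
    using card_range_shifted_residue_defect[OF assms]
    by (simp add: card_image inj_on_def)
qed

lemma card_range_gap_diff_fixed_right:
  assumes "m > 0"
  shows "card (range (\<lambda>(c, t). gap_diff m N c d t)) = Suc (m choose 2)"
proof -
  let ?f = "\<lambda>(a, b). \<delta> m a + \<delta> m b - \<delta> m (a + b - (d - N + 1))"
  define reparam where "reparam = (\<lambda>(c, t). (c + 1, t + d - c - N))"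
  have "(\<lambda>(c, t). gap_diff m N c d t) = (\<lambda>f. f - \<delta> m d) \<circ> ?f \<circ> reparam"
    by (simp add: reparam_def gap_diff_def fun_eq_iff algebra_simps)
  moreover have "surj reparam"
    by (rule surjI[where f = "\<lambda>(a, b). (a - 1, b + a - 1 - d + N)"]) (auto simp: reparam_def)
  ultimately have "range (\<lambda>(c, t). gap_diff m N c d t) = (\<lambda>f. f - \<delta> m d) ` range ?f"
    by (simp only: range_comp_surj)
  then show ?thesis
    using card_range_shifted_residue_defect[OF assms]
    by (simp add: card_image inj_on_def)
qed

lemma card_range_residue_fibres:
  fixes f :: "int \<Rightarrow> 'a \<Rightarrow> 'b"
  assumes "m > 0" "\<And>a. f (a mod int m) = f a" "\<And>a. finite (range (f a))"
  shows "card (range (\<lambda>(a, b). (a mod int m, f a b))) = (\<Sum>a\<in>{0..<int m}. card (range (f a)))"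
proof -
  have "range (\<lambda>(a, b). (a mod int m, f a b)) = (SIGMA a:{0..<int m}. range (f a))"
  proof (intro equalityI subsetI)
    fix x assume "x \<in> range (\<lambda>(a, b). (a mod int m, f a b))"
    then obtain a b where "x = (a mod int m, f (a mod int m) b)"
      using assms(2) by auto
    then show "x \<in> (SIGMA a:{0..<int m}. range (f a))"
      using assms(1) by simp
  next
    fix x assume "x \<in> (SIGMA a:{0..<int m}. range (f a))"
    then obtain a b where "a \<in> {0..<int m}" "x = (a, f a b)" by auto
    then have "x = (\<lambda>(a, b). (a mod int m, f a b)) (a, b)" by simp
    then show "x \<in> range (\<lambda>(a, b). (a mod int m, f a b))" by (rule range_eqI)
  qed
  then show ?thesis using assms(3) by simp
qed

definition framed_gap_diff ::
    "nat \<Rightarrow> bool \<Rightarrow> bool \<Rightarrow> int \<Rightarrow> int \<times> int \<times> int \<Rightarrow> int \<times> int \<times> (int \<Rightarrow> int)" where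
  "framed_gap_diff m l r N = (\<lambda>(c, d, t).
     (if l then c mod int m else 0, if r then d mod int m else 0, gap_diff m N c d t))"

lemma framed_gap_diff_cong:
  assumes "[N = N'] (mod int m)" "[c = c'] (mod int m)" "[d = d'] (mod int m)" "[t = t'] (mod int m)"
  shows "framed_gap_diff m l r N (c, d, t) = framed_gap_diff m l r N' (c', d', t')"
  using gap_diff_cong[OF assms] assms(2,3) by (simp add: framed_gap_diff_def cong_def)

lemma card_range_framed_gap_diff_both:
  assumes "m > 0"
  shows "card (range (framed_gap_diff m True True N)) = m ^ 3 - m ^ 2 + m"
proof -
  let ?g = "\<lambda>c. \<lambda>(d, t). (d mod int m, gap_diff m N c d t)"
  have mod: "gap_diff m N (c mod int m) d t = gap_diff m N c d t"
    "gap_diff m N c (d mod int m) t = gap_diff m N c d t" for c d t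
    by (intro gap_diff_cong; simp add: cong_def)+
  have fin: "finite (range (gap_diff m N c d))" for c d
    by (rule card_ge_0_finite) (use assms in \<open>simp add: card_range_gap_diff_fixed_ends\<close>)
  have card_g: "card (range (?g c)) = 1 + (m - 1) * m" for c
  proof -
    define d0 where "d0 = (c + N) mod int m"
    have d0: "d0 \<in> {0..<int m}" using assms by (simp add: d0_def)
    have "card (range (?g c)) = (\<Sum>d\<in>{0..<int m}. card (range (gap_diff m N c d)))"
      using fin by (intro card_range_residue_fibres[OF assms]) (simp_all add: mod fun_eq_iff)
    also have "\<dots> = (\<Sum>d\<in>{0..<int m}. if d = d0 then 1 else m)"
      using assms by (intro sum.cong) (auto simp: card_range_gap_diff_fixed_ends d0_def cong_def)
    also have "\<dots> = 1 + (m - 1) * m"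
      using d0 by (simp add: sum.delta_remove card_Diff_singleton)
    finally show ?thesis .
  qed
  have "framed_gap_diff m True True N = (\<lambda>(c, b). (c mod int m, ?g c b))"
    by (auto simp: framed_gap_diff_def)
  then have "card (range (framed_gap_diff m True True N)) = (\<Sum>c\<in>{0..<int m}. card (range (?g c)))"
    using card_range_residue_fibres[OF assms, of ?g] by (simp add: mod card_g card_ge_0_finite)
  also have "\<dots> = m * (1 + (m - 1) * m)"
    by (simp add: card_g)
  also have "\<dots> = m ^ 3 - m ^ 2 + m"
    using assms by (simp add: power3_eq_cube power2_eq_square algebra_simps)
  finally show ?thesis .
qed

lemma card_range_framed_gap_diff_left:
  assumes "m > 0"
  shows "card (range (framed_gap_diff m True False N)) = m * Suc (m choose 2)"
proof -
  let ?g = "\<lambda>c. \<lambda>(d, t). (0 :: int, gap_diff m N c d t)"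
  have mod: "gap_diff m N (c mod int m) d t = gap_diff m N c d t" for c d t
    by (intro gap_diff_cong; simp add: cong_def)
  have "range (?g c) = Pair 0 ` range (\<lambda>(d, t). gap_diff m N c d t)" for c
    by auto
  then have card_g: "card (range (?g c)) = Suc (m choose 2)" for c
    using card_range_gap_diff_fixed_left[OF assms] by (simp add: card_image inj_on_def)
  have "framed_gap_diff m True False N = (\<lambda>(c, b). (c mod int m, ?g c b))"
    by (auto simp: framed_gap_diff_def)
  then have "card (range (framed_gap_diff m True False N)) = (\<Sum>c\<in>{0..<int m}. card (range (?g c)))"
    using card_range_residue_fibres[OF assms, of ?g] by (simp add: mod card_g card_ge_0_finite)
  then show ?thesis by (simp add: card_g)
qed

lemma card_range_framed_gap_diff_right:
  assumes "m > 0"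
  shows "card (range (framed_gap_diff m False True N)) = m * Suc (m choose 2)"
proof -
  let ?g = "\<lambda>d. \<lambda>(c, t). gap_diff m N c d t"
  have mod: "gap_diff m N c (d mod int m) t = gap_diff m N c d t" for c d t
    by (intro gap_diff_cong; simp add: cong_def)
  define reorder :: "int \<times> int \<times> int \<Rightarrow> int \<times> int \<times> int" where "reorder = (\<lambda>(c, d, t). (d, c, t))"
  have "framed_gap_diff m False True N = Pair 0 \<circ> (\<lambda>(d, b). (d mod int m, ?g d b)) \<circ> reorder"
    by (simp add: framed_gap_diff_def reorder_def fun_eq_iff)
  moreover have "surj reorder"
    by (rule surjI[where f = reorder]) (auto simp: reorder_def)
  ultimately have
    "range (framed_gap_diff m False True N) = Pair 0 ` range (\<lambda>(d, b). (d mod int m, ?g d b))"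
    by (simp only: range_comp_surj)
  then have "card (range (framed_gap_diff m False True N)) =
      card (range (\<lambda>(d, b). (d mod int m, ?g d b)))"
    by (simp add: card_image inj_on_def)
  also have "\<dots> = (\<Sum>d\<in>{0..<int m}. card (range (?g d)))"
    using card_range_gap_diff_fixed_right[OF assms]
    by (intro card_range_residue_fibres[OF assms] card_ge_0_finite) (simp_all add: mod)
  finally show ?thesis by (simp add: card_range_gap_diff_fixed_right[OF assms])
qed

section \<open>Counting the classes\<close>

lemma card_quotient_image:
  assumes "\<And>s t. s \<in> A \<Longrightarrow> t \<in> A \<Longrightarrow> R (g s) (g t) \<longleftrightarrow> f s = f t"
  shows "card (g ` A // {(a, b). a \<in> g ` A \<and> b \<in> g ` A \<and> R a b}) = card (f ` A)"
proof -
  define fibre where "fibre v = g ` {t \<in> A. f t = v}" for v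
  have "{(a, b). a \<in> g ` A \<and> b \<in> g ` A \<and> R a b} `` {g s} = fibre (f s)" if "s \<in> A" for s
    using assms[OF that] that by (auto simp: fibre_def image_iff)
  then have "g ` A // {(a, b). a \<in> g ` A \<and> b \<in> g ` A \<and> R a b} = fibre ` f ` A"
    by (auto simp: quotient_def image_iff)
  moreover have "inj_on fibre (f ` A)"
  proof (rule inj_onI, clarify)
    fix s t assume st: "s \<in> A" "t \<in> A" "fibre (f s) = fibre (f t)"
    have "g s \<in> fibre (f s)" using st by (auto simp: fibre_def)
    then obtain r where "r \<in> A" "f r = f t" "g s = g r" using st by (auto simp: fibre_def)
    then show "f s = f t" using assms[of s r] assms[of s s] st by metis
  qed
  ultimately show ?thesis by (simp add: card_image)
qed

lemma border_equiv_append_iff: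
  assumes "m > 0"
    and words: "x \<in> words m" "y \<in> words m" "p \<in> words m" "q \<in> words m"
      "x' \<in> words m" "y' \<in> words m" "p' \<in> words m" "q' \<in> words m"
    and len: "length x < m ^ k" "length y < m ^ k" "length x' < m ^ k" "length y' < m ^ k"
  shows "border_equiv m (Suc k) (x @ sigma_pow m k p, sigma_pow m k q @ y)
      (x' @ sigma_pow m k p', sigma_pow m k q' @ y') \<longleftrightarrow>
    x = x' \<and> y = y' \<and>
    (abelian_equiv (p @ q) (p' @ q') \<or> abelian_equiv (p @ q) (p' @ q' @ sigma m [0]) \<or>
     abelian_equiv (p @ q @ sigma m [0]) (p' @ q'))" (is "?equiv \<longleftrightarrow> ?same")
proof
  assume same: ?same
  show ?equiv
    unfolding border_equiv_def
    by (rule bexI[of _ x], rule bexI[of _ y], rule bexI[of _ p], rule bexI[of _ q],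
        rule bexI[of _ p'], rule bexI[of _ q']) (use same words len in simp_all)
next
  assume ?equiv
  then obtain X Y P Q R T where XY: "X \<in> words m" "Y \<in> words m" "P \<in> words m" "Q \<in> words m"
      "R \<in> words m" "T \<in> words m" "length X < m ^ k" "length Y < m ^ k"
    and eqs: "x @ sigma_pow m k p = X @ sigma_pow m k P" "sigma_pow m k q @ y = sigma_pow m k Q @ Y"
      "x' @ sigma_pow m k p' = X @ sigma_pow m k R" "sigma_pow m k q' @ y' = sigma_pow m k T @ Y"
    and abelian: "abelian_equiv (P @ Q) (R @ T) \<or> abelian_equiv (P @ Q) (R @ T @ sigma m [0]) \<or>
      abelian_equiv (P @ Q @ sigma m [0]) (R @ T)"
    unfolding border_equiv_def by (simp only: diff_Suc_1 prod.inject) blast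
  have "x = X" "p = P" "x' = X" "p' = R"
    using append_sigma_pow_inject[OF assms(1) _ _ _ _ eqs(1)]
      append_sigma_pow_inject[OF assms(1) _ _ _ _ eqs(3)] words len XY by simp_all
  moreover have "y = Y" "q = Q" "y' = Y" "q' = T"
    using sigma_pow_append_inject[OF assms(1) _ _ _ _ eqs(2)]
      sigma_pow_append_inject[OF assms(1) _ _ _ _ eqs(4)] words len XY by simp_all
  ultimately show ?same using abelian by simp
qed

lemma border_equiv_iff_cyc_diff:
  assumes "m > 0"
    and words: "x \<in> words m" "y \<in> words m" "p \<in> words m" "q \<in> words m"
      "x' \<in> words m" "y' \<in> words m" "p' \<in> words m" "q' \<in> words m"
    and "length x < m ^ k" "length y < m ^ k" "length x' < m ^ k" "length y' < m ^ k"
    and len: "length (p @ q) < 2 * m" "length (p' @ q') < 2 * m"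
  shows "border_equiv m (Suc k) (x @ sigma_pow m k p, sigma_pow m k q @ y)
      (x' @ sigma_pow m k p', sigma_pow m k q' @ y') \<longleftrightarrow>
    x = x' \<and> y = y' \<and> cyc_diff m (p @ q) = cyc_diff m (p' @ q')"
  using abelian_equiv_up_to_sigma_iff_cyc_diff[OF assms(1) _ _ len] words
  by (simp add: border_equiv_append_iff[OF assms(1-13)] words_append)

lemma twice_mult_Suc_choose_two: "2 * (m * Suc (m choose 2)) = m ^ 3 - m ^ 2 + m + m"
proof -
  have "2 * (m choose 2) = m * (m - 1)"
    unfolding choose_two by (rule dvd_mult_div_cancel) auto
  then have "2 * (m * Suc (m choose 2)) = m * (m * (m - 1)) + 2 * m"
    by (simp add: algebra_simps)
  also have "\<dots> = m ^ 3 - m ^ 2 + m + m"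
    by (cases m) (simp_all add: power3_eq_cube power2_eq_square algebra_simps)
  finally show ?thesis .
qed

lemma
  fixes n K m a b :: nat
  assumes "n mod (K * m) = a * K + b" "b < K"
  shows div_eq_of_mod_mult_eq: "n div K = m * (n div (K * m)) + a"
    and dvd_iff_of_mod_mult_eq: "K dvd n \<longleftrightarrow> b = 0"
proof -
  have n: "n = K * (m * (n div (K * m)) + a) + b"
    using mult_div_mod_eq[of "K * m" n] unfolding assms(1) by (simp add: algebra_simps)
  show "n div K = m * (n div (K * m)) + a"
    by (subst n) (use assms(2) in simp)
  show "K dvd n \<longleftrightarrow> b = 0"
    by (subst n) (use assms(2) in \<open>auto simp: dvd_add_right_iff dest: dvd_imp_le\<close>)
qed

lemma dvd_add_Suc_iff:
  fixes K a n :: nat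
  assumes "a < K"
  shows "K dvd a + Suc n \<longleftrightarrow> a = K - Suc (n mod K)"
proof -
  define a0 where "a0 = K - Suc (n mod K)"
  have "n mod K < K" using assms by simp
  then have a0: "a0 < K" "a0 + Suc n = K + K * (n div K)"
    using mult_div_mod_eq[of K n] unfolding a0_def by linarith+
  have "K dvd a0 + Suc n" unfolding a0(2) by simp
  then have "K dvd a + Suc n \<longleftrightarrow> [a + Suc n = a0 + Suc n] (mod K)"
    by (auto simp: cong_def)
  also have "\<dots> \<longleftrightarrow> [a = a0] (mod K)"
    by (rule cong_add_rcancel_nat)
  also have "\<dots> \<longleftrightarrow> a = a0"
    using assms a0(1) by (auto dest: cong_less_modulus_unique_nat)
  finally show ?thesis by (simp only: a0_def)
qed

lemma sum_two_exceptional_residues: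
  fixes g h e f K n :: nat
  assumes "0 < K" "2 * h = g + f"
  shows "(\<Sum>a<K. if Suc a < K \<and> \<not> K dvd a + Suc n then g
      else if Suc a < K \<or> \<not> K dvd a + Suc n then h else e) =
    (K - 1) * g + (if K dvd n then e else f)" (is "sum ?f _ = _")
proof -
  define a0 where "a0 = K - Suc (n mod K)"
  obtain J where J: "K = Suc J" using assms(1) by (cases K) auto
  have dvd: "K dvd a + Suc n \<longleftrightarrow> a = a0" if "a < K" for a
    using that unfolding a0_def by (rule dvd_add_Suc_iff)
  have off_last: "?f a = (if a = a0 then h else g)" if "a < J" for a
    using that dvd[of a] J by simp
  show ?thesis
  proof (cases "K dvd n")
    case True
    then have "a0 = J" by (simp add: a0_def J)
    moreover from this have "sum ?f {..<J} = (\<Sum>a<J. g)"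
      using off_last by (intro sum.cong) simp_all
    moreover have "?f J = e" using \<open>a0 = J\<close> dvd[of J] by (simp add: J)
    ultimately show ?thesis using True by (simp add: J)
  next
    case False
    then have "0 < n mod K" by (simp add: mod_greater_zero_iff_not_dvd)
    then have a0: "a0 < J" using J mod_less_divisor[OF assms(1), of n] unfolding a0_def by linarith
    have "sum ?f {..<J} = (\<Sum>a<J. if a = a0 then h else g)"
      using off_last by (intro sum.cong) simp_all
    also have "\<dots> = h + (J - 1) * g"
      using a0 by (simp add: sum.delta_remove card_Diff_singleton)
    moreover have "?f J = h" using dvd[of J] a0 by (simp add: J)
    moreover have "J * g = (J - 1) * g + g" using a0 by (cases J) auto
    ultimately show ?thesis using False assms(2) by (simp add: J)
  qed
qed

context thue_morse
begin

lemma slice_block_eq_iff: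
  assumes "b \<le> m ^ k"
  shows "slice (m ^ k * q + a) (m ^ k * q + b) = slice (m ^ k * q' + a) (m ^ k * q' + b) \<longleftrightarrow>
    b \<le> a \<or> tm m q = tm m q'"
proof -
  have "slice (m ^ k * q + a) (m ^ k * q + b) = map (\<lambda>r. (tm m q + tm m r) mod m) [a..<b]" for q
    using assms tm_power_mult_add[of _ k q]
    by (intro nth_equalityI) (simp_all add: add.assoc)
  moreover have "(tm m q + x) mod m = (tm m q' + x) mod m \<longleftrightarrow> tm m q = tm m q'" for x
    using cong_add_rcancel_nat[of "tm m q" x "tm m q'" m] tm_less by (simp add: cong_def)
  ultimately show ?thesis by auto
qed

lemma
  assumes "a < m ^ k" "a' < m ^ k"
  shows slice_before_eq_iff:
      "slice (m ^ k * v) (m ^ k * v + a) = slice (m ^ k * v') (m ^ k * v' + a') \<longleftrightarrow>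
        a = a' \<and> (0 < a \<longrightarrow> tm m v = tm m v')" (is "?before \<longleftrightarrow> _")
    and slice_after_eq_iff:
      "slice (m ^ k * u + Suc a) (m ^ k * Suc u) = slice (m ^ k * u' + Suc a') (m ^ k * Suc u') \<longleftrightarrow>
        a = a' \<and> (Suc a < m ^ k \<longrightarrow> tm m u = tm m u')" (is "?after \<longleftrightarrow> _")
proof -
  have "a = a'" if ?before
    using arg_cong[OF that, of length] by simp
  then show "?before \<longleftrightarrow> a = a' \<and> (0 < a \<longrightarrow> tm m v = tm m v')"
    using assms slice_block_eq_iff[of a k v 0 v'] by auto
  have "a = a'" if ?after
    using arg_cong[OF that, of length] assms by simp
  then show "?after \<longleftrightarrow> a = a' \<and> (Suc a < m ^ k \<longrightarrow> tm m u = tm m u')"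
    using slice_block_eq_iff[of "m ^ k" k u "Suc a" u'] by (auto simp: add.commute)
qed

abbreviation block_after :: "nat \<Rightarrow> nat list" where
  "block_after u \<equiv> slice (Suc u) (m * Suc (u div m))"

abbreviation block_before :: "nat \<Rightarrow> nat list" where
  "block_before v \<equiv> slice (m * (v div m)) v"

lemma Suc_le_block_end: "Suc u \<le> m * Suc (u div m)"
  using dividend_less_times_div[OF m_pos, of u] by (simp add: Suc_le_eq)

lemma length_block_after_before: "length (block_after u @ block_before v) < 2 * m"
proof -
  have "v - m * (v div m) < m"
    using m_pos by (simp add: minus_mult_div_eq_mod)
  moreover have "m * Suc (u div m) - Suc u < m"
    using m_pos times_div_less_eq_dividend[of m u] by (simp only: mult_Suc_right)
  ultimately show ?thesis by simp
qed

lemma cyc_diff_block_after_before: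
  assumes "u < v"
  shows "cyc_diff m (block_after u @ block_before v) = cyc_diff m (slice (Suc u) v)"
proof -
  have "m * Suc (u div m) div m = Suc (u div m)"
    using m_pos by (simp only: nonzero_mult_div_cancel_left)
  then show ?thesis
    using assms m_pos Suc_le_block_end[of u]
    by (simp add: cyc_diff_append cyc_diff_slice tm_mult del: mult_Suc_right)
qed

lemma border_slice_decomp:
  assumes "a < m ^ k" "b < m ^ k" "Suc (m ^ k * u + a) + 2 * m ^ Suc k \<le> m ^ k * v + b"
  shows "border m (Suc k) (slice (m ^ k * u + Suc a) (m ^ k * v + b)) =
    (slice (m ^ k * u + Suc a) (m ^ k * Suc u) @ sigma_pow m k (block_after u),
     sigma_pow m k (block_before v) @ slice (m ^ k * v) (m ^ k * v + b))"
proof -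
  have div: "(m ^ k * w + c) div m ^ Suc k = w div m" if "c < m ^ k" for w c
    using that m_pos by (simp add: power_Suc2 div_mult2_eq del: power_Suc)
  have pow: "m ^ Suc k * q = m ^ k * (m * q)" for q
    by (simp add: mult.left_commute)
  have "slice (m ^ k * u + Suc a) (m ^ k * Suc u) @
        slice (m ^ k * Suc u) (m ^ k * (m * Suc (u div m))) =
      slice (m ^ k * u + Suc a) (m ^ k * (m * Suc (u div m)))"
    using assms(1) by (intro slice_append mult_le_mono2 Suc_le_block_end) simp
  moreover have "slice (m ^ k * (m * (v div m))) (m ^ k * v) @ slice (m ^ k * v) (m ^ k * v + b) =
      slice (m ^ k * (m * (v div m))) (m ^ k * v + b)"
    by (intro slice_append mult_le_mono2) simp_all
  ultimately show ?thesis
    using border_slice[OF assms(3)] assms(1,2) by (simp only: div pow sigma_pow_slice add_Suc_right)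
qed

lemma border_equiv_slice_iff:
  assumes ab: "a < m ^ k" "b < m ^ k" "a' < m ^ k" "b' < m ^ k"
    and long: "Suc (m ^ k * u + a) + 2 * m ^ Suc k \<le> m ^ k * v + b"
      "Suc (m ^ k * u' + a') + 2 * m ^ Suc k \<le> m ^ k * v' + b'"
  shows "border_equiv m (Suc k)
      (border m (Suc k) (slice (m ^ k * u + Suc a) (m ^ k * v + b)))
      (border m (Suc k) (slice (m ^ k * u' + Suc a') (m ^ k * v' + b'))) \<longleftrightarrow>
    (a = a' \<and> (Suc a < m ^ k \<longrightarrow> tm m u = tm m u')) \<and> (b = b' \<and> (0 < b \<longrightarrow> tm m v = tm m v')) \<and>
    cyc_diff m (slice (Suc u) v) = cyc_diff m (slice (Suc u') v')"
proof -
  have less: "u < v" if "Suc (m ^ k * u + a) + 2 * m ^ Suc k \<le> m ^ k * v + b" "b < m ^ k" for u v a b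
  proof (rule ccontr)
    assume "\<not> u < v"
    then have "m ^ k * v \<le> m ^ k * u" by simp
    moreover have "m ^ k \<le> m ^ Suc k" using m_pos by simp
    ultimately show False using that by linarith
  qed
  show ?thesis
    unfolding border_slice_decomp[OF ab(1,2) long(1)] border_slice_decomp[OF ab(3,4) long(2)]
    using ab less[OF long(1) ab(2)] less[OF long(2) ab(4)]
    by (subst border_equiv_iff_cyc_diff[OF m_pos])
      (simp_all only: slice_in_words length_block_after_before slice_before_eq_iff slice_after_eq_iff
        cyc_diff_block_after_before, simp_all)
qed

definition framed_cyc_diff :: "bool \<Rightarrow> bool \<Rightarrow> nat \<Rightarrow> nat \<Rightarrow> int \<times> int \<times> (int \<Rightarrow> int)" where
  "framed_cyc_diff l r N u =
     (if l then int (tm m u) else 0, if r then int (tm m (u + N)) else 0,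
      cyc_diff m (slice (Suc u) (u + N)))"

abbreviation offset_invariant :: "nat \<Rightarrow> nat \<Rightarrow> nat \<Rightarrow> nat \<Rightarrow> int \<times> int \<times> (int \<Rightarrow> int)" where
  "offset_invariant k n a \<equiv>
     framed_cyc_diff (Suc a < m ^ k) (\<not> m ^ k dvd a + Suc n) ((a + Suc n) div m ^ k)"

text \<open>An occurrence of a factor is given by the position \<open>p\<close> of the letter before it; every factor has
  one with \<open>p\<close> a natural number, because \<open>t\<^sub>m\<close> is recurrent.\<close>

definition border_invariant :: "nat \<Rightarrow> nat \<Rightarrow> nat \<Rightarrow> nat \<times> int \<times> int \<times> (int \<Rightarrow> int)" where
  "border_invariant k n p = (let a = p mod m ^ k in (a, offset_invariant k n a (p div m ^ k)))"

lemma border_equiv_iff_border_invariant: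
  assumes "2 * m ^ Suc k \<le> n"
  shows "border_equiv m (Suc k) (border m (Suc k) (slice (Suc p) (p + Suc n)))
      (border m (Suc k) (slice (Suc p') (p' + Suc n))) \<longleftrightarrow>
    border_invariant k n p = border_invariant k n p'"
proof -
  define K where "K = m ^ k"
  have K: "0 < K" using m_pos by (simp add: K_def)
  define gap where "gap a = (a + Suc n) div K" for a
  define rest where "rest a = (a + Suc n) mod K" for a
  have rest: "rest a < K" "0 < rest a \<longleftrightarrow> \<not> K dvd a + Suc n" for a
    using K by (simp_all add: rest_def mod_greater_zero_iff_not_dvd)
  have start_eq: "Suc p = K * (p div K) + Suc (p mod K)" for p by simp
  have "p + Suc n = K * (p div K) + (p mod K + Suc n)" for p by simp
  then have end_eq: "p + Suc n = K * (p div K + gap (p mod K)) + rest (p mod K)" for p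
    unfolding gap_def rest_def add_mult_distrib2 by (metis add.assoc mult_div_mod_eq)
  have long: "Suc (K * (p div K) + p mod K) + 2 * m ^ Suc k \<le>
      K * (p div K + gap (p mod K)) + rest (p mod K)" for p
    using assms unfolding end_eq[symmetric] by simp
  show ?thesis
    unfolding start_eq[of p] start_eq[of p'] end_eq[of p] end_eq[of p']
    using border_equiv_slice_iff[OF _ _ _ _ long[unfolded K_def] long[unfolded K_def], of p p'] K rest
    by (auto simp: border_invariant_def Let_def framed_cyc_diff_def gap_def simp flip: K_def)
qed

lemma range_border_invariant:
  "range (border_invariant k n) = (SIGMA a:{..<m ^ k}. range (offset_invariant k n a))"
proof (intro equalityI subsetI)
  fix x assume "x \<in> range (border_invariant k n)"
  then show "x \<in> (SIGMA a:{..<m ^ k}. range (offset_invariant k n a))"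
    using m_pos by (auto simp: border_invariant_def Let_def)
next
  fix x assume "x \<in> (SIGMA a:{..<m ^ k}. range (offset_invariant k n a))"
  then obtain a u where "a < m ^ k" "x = (a, offset_invariant k n a u)"
    by auto
  then have "x = border_invariant k n (m ^ k * u + a)"
    using m_pos by (simp add: border_invariant_def)
  then show "x \<in> range (border_invariant k n)" by (rule range_eqI)
qed

lemma ex_tm_triple:
  assumes "m \<le> N"
  shows "\<exists>u. [int (tm m u) = c] (mod int m) \<and> [int (tm m (u + N)) = d] (mod int m) \<and>
    [int (tm m (u div m)) = t] (mod int m)"
proof -
  define r where "r = nat ((c - t) mod int m)"
  have r: "r < m" "[int r = c - t] (mod int m)"
    using m_pos by (simp_all add: r_def nat_less_iff cong_def)
  have "1 \<le> (r + N) div m"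
    using assms m_pos by (simp add: div_greater_zero_iff Suc_le_eq)
  then obtain q where q: "tm m q = nat (t mod int m)"
    "tm m (q + (r + N) div m) = nat ((d - int (r + N)) mod int m)"
    using ex_tm_pair[of "(r + N) div m" "nat (t mod int m)" "nat ((d - int (r + N)) mod int m)"] m_pos
    by (auto simp: nat_less_iff)
  define u where "u = m * q + r"
  have u: "u div m = q" "(u + N) div m = q + (r + N) div m"
    using r(1) m_pos by (simp_all add: u_def add.assoc)
  have t: "[int (tm m (u div m)) = t] (mod int m)"
    using m_pos by (simp add: u(1) q(1) cong_def)
  have "[int (tm m u) = int (tm m (u div m)) + int u] (mod int m)"
    using tm_cong[of u] by (simp flip: cong_int_iff)
  also have "[int (tm m (u div m)) + int u = t + (c - t)] (mod int m)"
    using r(2) by (intro cong_add t) (simp add: u_def cong_def)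
  finally have c: "[int (tm m u) = c] (mod int m)" by simp
  have "[int (tm m (u + N)) = int (tm m ((u + N) div m)) + int (u + N)] (mod int m)"
    using tm_cong[of "u + N"] by (simp flip: cong_int_iff)
  also have "[int (tm m ((u + N) div m)) + int (u + N) = (d - int (r + N)) + int (r + N)] (mod int m)"
    using m_pos by (intro cong_add) (simp_all add: u(2) q(2) u_def cong_def add.assoc)
  finally have "[int (tm m (u + N)) = d] (mod int m)" by simp
  with c t show ?thesis by blast
qed

lemma framed_cyc_diff_eq_framed_gap_diff:
  assumes "0 < N"
  shows "framed_cyc_diff l r N u = framed_gap_diff m l r (int N)
    (int (tm m u), int (tm m (u + N)), int (tm m (u div m)))"
proof -
  have cong: "[int (tm m i) = int (tm m (i div m)) + int i] (mod int m)" for i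
    using tm_cong[of i] by (simp flip: cong_int_iff)
  have "[int (tm m (u div m)) + int (tm m (u + N)) - int (tm m u) - int N =
      int (tm m (u div m)) + (int (tm m ((u + N) div m)) + int (u + N)) -
      (int (tm m (u div m)) + int u) - int N] (mod int m)"
    by (intro cong_diff cong_add cong cong_refl)
  then have last: "\<delta> m (int (tm m (u div m)) + int (tm m (u + N)) - int (tm m u) - int N) =
      \<delta> m (int (tm m ((u + N) div m)))"
    by (intro residue_indicator_cong) simp
  have letter: "cyc_diff m (slice u (u + N)) = cyc_diff m [tm m u] + cyc_diff m (slice (Suc u) (u + N))"
    using assms by (simp add: upt_conv_Cons flip: cyc_diff_append)
  have "cyc_diff m (slice (Suc u) (u + N)) =
      gap_diff m (int N) (int (tm m u)) (int (tm m (u + N))) (int (tm m (u div m)))"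
    unfolding gap_diff_def last
    using letter by (simp add: cyc_diff_letter cyc_diff_slice algebra_simps)
  then show ?thesis
    using tm_less by (simp add: framed_cyc_diff_def framed_gap_diff_def)
qed

lemma range_framed_cyc_diff:
  assumes "m \<le> N"
  shows "range (framed_cyc_diff l r N) = range (framed_gap_diff m l r (int N))"
proof (intro equalityI subsetI)
  fix x assume "x \<in> range (framed_cyc_diff l r N)"
  then show "x \<in> range (framed_gap_diff m l r (int N))"
    using assms m_pos by (auto simp: framed_cyc_diff_eq_framed_gap_diff)
next
  fix x assume "x \<in> range (framed_gap_diff m l r (int N))"
  then obtain c d t where x: "x = framed_gap_diff m l r (int N) (c, d, t)" by auto
  obtain u where "[int (tm m u) = c] (mod int m)" "[int (tm m (u + N)) = d] (mod int m)"
    "[int (tm m (u div m)) = t] (mod int m)"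
    using ex_tm_triple[OF assms] by blast
  then have "x = framed_cyc_diff l r N u"
    using assms m_pos
    by (simp add: x framed_cyc_diff_eq_framed_gap_diff
        framed_gap_diff_cong[OF cong_refl cong_sym cong_sym cong_sym])
  then show "x \<in> range (framed_cyc_diff l r N)" by (rule range_eqI)
qed

lemma abelian_complexity_eq_card_framed_cyc_diff:
  "abelian_complexity m n = card (range (framed_cyc_diff False False (Suc n)))"
proof -
  have "abelian_equiv (slice (Suc p) (p + Suc n)) (slice (Suc p') (p' + Suc n)) \<longleftrightarrow>
      framed_cyc_diff False False (Suc n) p = framed_cyc_diff False False (Suc n) p'" for p p'
    unfolding framed_cyc_diff_def
    by (subst abelian_equiv_iff_cyc_diff[OF m_pos slice_in_words slice_in_words]) simp_all
  then show ?thesis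
    unfolding abelian_complexity_def factors_eq_range_slice
    by (intro card_quotient_image)
qed

lemma abelian_complexity_cong:
  assumes "m \<le> Suc n" "m \<le> Suc n'" "[n = n'] (mod m)"
  shows "abelian_complexity m n = abelian_complexity m n'"
proof -
  have "[int (Suc n) = int (Suc n')] (mod int m)"
    using assms(3) cong_add_rcancel_nat[of n 1 n' m] by (simp only: cong_int_iff Suc_eq_plus1)
  then have "framed_gap_diff m l r (int (Suc n)) = framed_gap_diff m l r (int (Suc n'))" for l r
    by (intro ext) (clarify, intro framed_gap_diff_cong cong_refl)
  then show ?thesis
    by (simp only: abelian_complexity_eq_card_framed_cyc_diff range_framed_cyc_diff assms(1,2))
qed

lemma finite_range_framed_cyc_diff: "finite (range (framed_cyc_diff l r N))"
proof (rule finite_subset)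
  let ?middle = "{w. set w \<subseteq> {..<m} \<and> length w = N - 1}"
  show "range (framed_cyc_diff l r N) \<subseteq> {0..<int m} \<times> {0..<int m} \<times> cyc_diff m ` ?middle"
    using m_pos by (auto simp: framed_cyc_diff_def tm_less intro!: imageI)
  show "finite ({0..<int m} \<times> {0..<int m} \<times> cyc_diff m ` ?middle)"
    by (intro finite_cartesian_product finite_imageI finite_lists_length_eq) simp_all
qed

lemma card_border_classes_eq_sum:
  assumes "2 * m ^ Suc k \<le> n"
  shows "card (border_classes m (Suc k) n) = (\<Sum>a<m ^ k. card (range (offset_invariant k n a)))"
proof -
  have "card (border_classes m (Suc k) n) = card (range (border_invariant k n))"
    unfolding border_classes_def Let_def factors_eq_range_slice image_image
    using border_equiv_iff_border_invariant[OF assms]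
    by (intro card_quotient_image)
  also have "\<dots> = (\<Sum>a<m ^ k. card (range (offset_invariant k n a)))"
    unfolding range_border_invariant by (intro card_SigmaI) (simp_all add: finite_range_framed_cyc_diff)
  finally show ?thesis .
qed

lemma card_range_framed_cyc_diff:
  assumes "m \<le> N"
  shows "card (range (framed_cyc_diff l r N)) =
    (if l \<and> r then m ^ 3 - m ^ 2 + m
     else if l \<or> r then m * Suc (m choose 2)
     else abelian_complexity m (N - 1))"
proof -
  have "abelian_complexity m (N - 1) = card (range (framed_cyc_diff False False N))"
    using assms m_pos by (simp add: abelian_complexity_eq_card_framed_cyc_diff)
  then show ?thesis
    using card_range_framed_gap_diff_both[OF m_pos] card_range_framed_gap_diff_left[OF m_pos]
      card_range_framed_gap_diff_right[OF m_pos]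
    by (cases l; cases r) (simp_all add: range_framed_cyc_diff[OF assms])
qed

lemma card_border_classes:
  assumes "2 * m ^ Suc k \<le> n"
  shows "card (border_classes m (Suc k) n) = (m ^ k - 1) * (m ^ 3 - m ^ 2 + m) +
    (if m ^ k dvd n then abelian_complexity m (n div m ^ k) else m)"
proof -
  define K where "K = m ^ k"
  have K: "0 < K" using m_pos by (simp add: K_def)
  let ?generic = "m ^ 3 - m ^ 2 + m" and ?one_sided = "m * Suc (m choose 2)"
    and ?empty = "abelian_complexity m (n div K)"
  define gap where "gap a = (a + Suc n) div K" for a
  have gap_ge: "m \<le> gap a" for a
  proof -
    have "m * K \<le> a + Suc n" using assms by (simp add: K_def)
    then have "m * K div K \<le> gap a" unfolding gap_def by (rule div_le_mono)
    then show ?thesis using K by simp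
  qed
  have gap_last: "gap a = Suc (n div K)" if "a < K" "\<not> Suc a < K" for a
  proof -
    have last: "a + Suc n = K + n" using that by simp
    show ?thesis unfolding gap_def last using K by simp
  qed
  have "card (border_classes m (Suc k) n) =
      (\<Sum>a<K. card (range (framed_cyc_diff (Suc a < K) (\<not> K dvd a + Suc n) (gap a))))"
    using card_border_classes_eq_sum[OF assms] by (simp only: K_def gap_def)
  also have "\<dots> = (\<Sum>a<K.
      if Suc a < K \<and> \<not> K dvd a + Suc n then ?generic
      else if Suc a < K \<or> \<not> K dvd a + Suc n then ?one_sided else ?empty)"
    by (intro sum.cong refl) (simp add: card_range_framed_cyc_diff[OF gap_ge] gap_last)
  also have "\<dots> = (K - 1) * ?generic + (if K dvd n then ?empty else m)"
    using K twice_mult_Suc_choose_two by (rule sum_two_exceptional_residues)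
  finally show ?thesis by (simp only: K_def)
qed

end

theorem theorem6p5:
  fixes m k n lam nu mu :: nat
  assumes "m \<ge> 2" and "k \<ge> 2" and "n \<ge> 2 * m ^ k"
    and "lam = n mod m ^ k"
    and "lam = nu * m ^ (k - 1) + mu"
    and "nu < m" and "mu < m ^ (k - 1)"
  shows "card (border_classes m k n) =
    (m ^ (k - 1) - 1) * (m ^ 3 - m ^ 2 + m)
    + (if mu = 0 then abelian_complexity m (m + nu) else m)"
proof -
  interpret thue_morse m by unfold_locales (rule assms(1))
  have k: "Suc (k - 1) = k" using assms(2) by simp
  have pow: "m ^ k = m ^ (k - 1) * m"
    using power_Suc2[of m "k - 1"] by (simp only: k)
  have mod: "n mod (m ^ (k - 1) * m) = nu * m ^ (k - 1) + mu"
    using assms(4,5) unfolding pow by (simp only:)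
  have "2 \<le> n div m ^ k"
    using div_le_mono[OF assms(3), of "m ^ k"] m_pos by simp
  then have "m * 1 \<le> m * (n div m ^ k)"
    by (intro mult_le_mono2) simp
  then have "m \<le> Suc (m * (n div m ^ k) + nu)"
    by linarith
  then have "abelian_complexity m (n div m ^ (k - 1)) = abelian_complexity m (m + nu)"
    unfolding div_eq_of_mod_mult_eq[OF mod assms(7), folded pow]
    by (intro abelian_complexity_cong) (simp_all add: cong_def)
  then show ?thesis
    using card_border_classes[of "k - 1" n, unfolded k, OF assms(3)]
      dvd_iff_of_mod_mult_eq[OF mod assms(7)] by simp
qed

end
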